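(* Let $t\ge2$, $k\ge1$, $n\ge 1$, let $\mathbb F$ be a field, let $I_1,\ldots,I_t\subseteq[n]$, and let $G$ be a tree assignment of the support hypergraph $H(I_1,\ldots,I_t)$ with exactly $k(t-1)$ labelled graph-edge occurrences. Let $M_G(x)$ be the associated square selected matrix and let $\mathfrak D_k(G)$ be the set of ordered $k$-tree decompositions of $G$. For $1\le s\le n$ let $L_s=\{f\in E(G):s(f)=s\}$. For $\mathcal Q=(Q_0,\ldots,Q_{k-1})\in\mathfrak D_k(G)$ define $\sigma_s(\mathcal Q)=\sum_{i=0}^{k-1}i\,|E(Q_i)\cap L_s|$ and $x^{\sigma(\mathcal Q)}=\prod_{s=1}^n x_s^{\sigma_s(\mathcal Q)}$. Then, relative to the fixed row and column orders, for every $\mathcal Q\in\mathfrak D_k(G)$ there is a sign $\epsilon(\mathcal Q)\in\mathbb F^\times$, the image of an integer sign $\pm1$, such that $$\det M_G(x)=\sum_{\mathcal Q\in\mathfrak D_k(G)}c_G(\mathcal Q)\,x^{\sigma(\mathcal Q)},\qquad c_G(\mathcal Q)=\epsilon(\mathcal Q)\prod_{i=0}^{k-1}\det B_t[E(K_t)\setminus\underline{Q_i}]\in\mathbb F^\times ,$$ where the sum is indexed by decompositions (equal monomials not yet combined). Consequently, for every $\alpha\in\mathbb Z_{\ge0}^n$, the coefficient of $x^\alpha=\prod_{s=1}^n x_s^{\alpha_s}$ in $\det M_G(x)$ is $$[x^\alpha]\det M_G(x)=\sum_{\substack{\mathcal Q\in\mathfrak D_k(G)\\ \sigma(\mathcal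 Q)=\alpha}}c_G(\mathcal Q).$$ Thus every scalar $c_G(\mathcal Q)$ is nonzero over $\mathbb F$, including in characteristic $2$, whereas a collected coefficient may vanish (that is, there exist integers $t\ge2$, $k\ge1$, $n\ge1$, a field $\mathbb F$, sets $I_1,\ldots,I_t\subseteq[n]$, a tree assignment $G$ of $H(I_1,\ldots,I_t)$ with exactly $k(t-1)$ labelled graph-edge occurrences, and $\alpha\in\mathbb Z_{\ge0}^n$ for which the last sum has a nonempty index set but equals $0$).
   Context: Support hypergraph. For $s\in[n]$ let $e_s=\{j\in[t]:s\in I_j\}$. $H(I_1,\ldots,I_t)$ is the labelled multihypergraph on $[t]$ whose hyperedge occurrences are the pairs $(s,e_s)$ with $|e_s|\ge2$ (equal supports with different $s$ are distinct occurrences). Tree assignments. A tree assignment chooses, for each occurrence $(s,e_s)$, a simple tree $F_{e_s}$ with vertex set $e_s$, all of whose edges are labelled by that occurrence; $G$ is the labelled multigraph on $[t]$ formed by the disjoint union of all these labelled edge occurrences. For $f\in E(G)$ let $a(f)\in E(K_t)$ be its unordered endpoint pair and $s(f)\in[n]$ the index of its hyperedge occurrence. An ordered $k$-tree decomposition of $G$ is an ordered partition $E(G)=E(Q_0)\,\dot\cup\cdots\dot\cup\,E(Q_{k-1})$ of all edge occurrences such that each $Q_i$ is a spanning tree of $[t]$ (containing no parallel pair). For a labelled subgraph $Q$ of $G$, $\underline Q=\{a(f):f\in E(Q)\}\subseteq E(K_t)$. The matrix $B_t$. $K_t$ is the complete graph on $[t]$, $m=\binom t2$, $r=\binom{t-1}2=m-(t-1)$.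 Orient each edge from smaller to larger endpoint and order $E(K_t)$ lexicographically. $B_t$ is the $r\times m$ matrix over $\mathbb F$ with columns indexed by $E(K_t)$ and rows indexed by pairs $1\le u<v\le t-1$; the row $(u,v)$ is the circulation vector of the triangle $u,v,t$: entry $1$ at $\{u,v\}$, $1$ at $\{v,t\}$, $-1$ at $\{u,t\}$, and $0$ elsewhere. For $t=2$ it is the empty $0\times1$ matrix. $B_t[Y]$ is the column submatrix indexed by $Y\subseteq E(K_t)$, columns in the inherited order. The determinant of the empty $0\times0$ matrix is $1$. The matrix $M_G(x)$. $x_1,\ldots,x_n$ are algebraically independent over $\mathbb F$. $M_G(x)$ has $km$ columns indexed by $(i,a)\in\{0,\ldots,k-1\}\times E(K_t)$ (ordered first by $i$, then by $a$). Its top $kr$ rows form $I_k\otimes B_t$. Below these, in some fixed order, there is one row $R_f$ for each $f\in E(G)$; the entry of $R_f$ in column $(i,a)$ is $x_{s(f)}^i$ if $a=a(f)$ and $0$ otherwise. Since $|E(G)|=k(t-1)$, the matrix is square of size $km$. *)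

theory Defs
  imports
    "Jordan_Normal_Form.Determinant"
    "Jordan_Normal_Form.DL_Submatrix"
    "HOL-Library.Poly_Mapping"
    "HOL-Library.Z2"
begin

section \<open>Trees in labelled multigraphs\<close>

text \<open>A multigraph is given by a vertex set \<open>V\<close>, a set \<open>E\<close> of edge occurrences and a map
  \<open>ends\<close> sending an occurrence to its unordered endpoint pair. Cycles of length two are parallel
  pairs, so a tree contains none; for a simple graph take \<open>ends = id\<close>. The trees of
  \<open>Graph_Theory\<close> are not used because acyclicity there only excludes directed cycles.\<close>

definition graph_cycle :: "('e \<Rightarrow> 'v set) \<Rightarrow> 'e set \<Rightarrow> 'v list \<Rightarrow> 'e list \<Rightarrow> bool" where
  "graph_cycle ends E vs es \<longleftrightarrow>
     length vs \<ge> 2 \<and> length es = length vs \<and> distinct vs \<and> distinct es \<and> set es \<subseteq> E \<and>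
     (\<forall>i<length vs. ends (es ! i) = {vs ! i, vs ! (Suc i mod length vs)})"

definition graph_connected :: "('e \<Rightarrow> 'v set) \<Rightarrow> 'v set \<Rightarrow> 'e set \<Rightarrow> bool" where
  "graph_connected ends V E \<longleftrightarrow>
     V \<noteq> {} \<and> (\<forall>u\<in>V. \<forall>v\<in>V. (u, v) \<in> {(x, y). \<exists>f\<in>E. ends f = {x, y}}\<^sup>*)"

definition is_tree :: "('e \<Rightarrow> 'v set) \<Rightarrow> 'v set \<Rightarrow> 'e set \<Rightarrow> bool" where
  "is_tree ends V E \<longleftrightarrow>
     (\<forall>f\<in>E. ends f \<subseteq> V \<and> card (ends f) = 2) \<and>
     graph_connected ends V E \<and> \<not> (\<exists>vs es. graph_cycle ends E vs es)"

section \<open>Support hypergraph and tree assignments\<close>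

type_synonym occurrence = "nat \<times> nat set"         \<comment> \<open>hyperedge occurrence \<open>(s, e_s)\<close>\<close>
type_synonym lab_edge = "occurrence \<times> nat set"     \<comment> \<open>occurrence and endpoint pair\<close>

definition support :: "nat \<Rightarrow> (nat \<Rightarrow> nat set) \<Rightarrow> nat \<Rightarrow> nat set" where
  "support t I s = {j \<in> {1..t}. s \<in> I j}"

definition hyperedges :: "nat \<Rightarrow> nat \<Rightarrow> (nat \<Rightarrow> nat set) \<Rightarrow> occurrence set" where
  "hyperedges t n I = {(s, support t I s) | s. s \<in> {1..n} \<and> card (support t I s) \<ge> 2}"

definition tree_assignment ::
    "nat \<Rightarrow> nat \<Rightarrow> (nat \<Rightarrow> nat set) \<Rightarrow> (occurrence \<Rightarrow> nat set set) \<Rightarrow> bool" where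
  "tree_assignment t n I T \<longleftrightarrow> (\<forall>(s, e) \<in> hyperedges t n I. is_tree id e (T (s, e)))"

definition assignment_edges ::
    "nat \<Rightarrow> nat \<Rightarrow> (nat \<Rightarrow> nat set) \<Rightarrow> (occurrence \<Rightarrow> nat set set) \<Rightarrow> lab_edge set" where
  "assignment_edges t n I T = (SIGMA h : hyperedges t n I. T h)"

definition edge_ends :: "lab_edge \<Rightarrow> nat set" where
  "edge_ends f = snd f"

definition edge_label :: "lab_edge \<Rightarrow> nat" where
  "edge_label f = fst (fst f)"

definition tree_decomps :: "nat \<Rightarrow> nat \<Rightarrow> lab_edge set \<Rightarrow> lab_edge set list set" where
  "tree_decomps t k E =
     {Q. length Q = k \<and>
         (\<forall>i<k. \<forall>j<k. i \<noteq> j \<longrightarrow> Q ! i \<inter> Q ! j = {}) \<and>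
         (\<Union>i<k. Q ! i) = E \<and>
         (\<forall>i<k. is_tree edge_ends {1..t} (Q ! i))}"

definition sigma :: "nat \<Rightarrow> lab_edge set \<Rightarrow> lab_edge set list \<Rightarrow> nat \<Rightarrow> nat" where
  "sigma k E Q s = (\<Sum>i<k. i * card (Q ! i \<inter> {f \<in> E. edge_label f = s}))"

section \<open>The matrices\<close>

text \<open>The pairs \<open>1 \<le> u < v \<le> t\<close> in lexicographic order.\<close>

definition lex_pairs :: "nat \<Rightarrow> (nat \<times> nat) list" where
  "lex_pairs t = concat (map (\<lambda>u. map (Pair u) [u + 1..<t + 1]) [1..<t + 1])"

definition K_edges :: "nat \<Rightarrow> nat set list" where
  "K_edges t = map (\<lambda>(u, v). {u, v}) (lex_pairs t)"

text \<open>Matrix indices start at \<open>0\<close>: column \<open>q\<close> belongs to the edge \<open>K_edges t ! q\<close> and row \<open>p\<close> to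
  the triangle \<open>u, v, t\<close> with \<open>(u, v) = lex_pairs (t - 1) ! p\<close>. Entries lie in an arbitrary
  commutative ring, so that the same matrix is available over the field and over its polynomial
  ring.\<close>

definition B_mat :: "nat \<Rightarrow> 'b :: comm_ring_1 mat" where
  "B_mat t = mat ((t - 1) choose 2) (t choose 2) (\<lambda>(p, q).
     let (u, v) = lex_pairs (t - 1) ! p; a = K_edges t ! q in
       if a = {u, v} \<or> a = {v, t} then 1 else if a = {u, t} then -1 else 0)"

definition B_cols :: "nat \<Rightarrow> nat set set \<Rightarrow> 'b :: comm_ring_1 mat" where
  "B_cols t Y = submatrix (B_mat t) UNIV {q. q < t choose 2 \<and> K_edges t ! q \<in> Y}"

text \<open>With \<open>m = t choose 2\<close> and \<open>r = (t - 1) choose 2\<close>, column \<open>(i, a)\<close> of the selected matrix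
  has index \<open>i * m + q\<close>, where \<open>a = K_edges t ! q\<close>. The list \<open>fs\<close> enumerates the edge
  occurrences of \<open>G\<close>, which fixes the order of the bottom rows; \<open>x\<close> is the family of
  variables.\<close>

definition M_mat ::
    "nat \<Rightarrow> nat \<Rightarrow> lab_edge list \<Rightarrow> (nat \<Rightarrow> 'b) \<Rightarrow> 'b :: comm_ring_1 mat" where
  "M_mat t k fs x =
     (let m = t choose 2; r = (t - 1) choose 2 in
      mat (k * r + length fs) (k * m) (\<lambda>(p, c).
        if p < k * r then (if p div r = c div m then B_mat t $$ (p mod r, c mod m) else 0)
        else (let f = fs ! (p - k * r) in
              if edge_ends f = K_edges t ! (c mod m) then x (edge_label f) ^ (c div m) else 0)))"

section \<open>Polynomials\<close>

text \<open>The monoid algebra of finitely supported exponent vectors is the polynomial ring in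
  variables indexed by \<open>nat\<close>; the coefficient of \<open>x^\<alpha>\<close> in \<open>p\<close> is \<open>lookup p \<alpha>\<close>.\<close>

type_synonym 'a mpoly = "(nat \<Rightarrow>\<^sub>0 nat) \<Rightarrow>\<^sub>0 'a"

definition Const :: "'a :: comm_ring_1 \<Rightarrow> 'a mpoly" where
  "Const c = Poly_Mapping.single 0 c"

definition Var :: "nat \<Rightarrow> 'a :: comm_ring_1 mpoly" where
  "Var s = Poly_Mapping.single (Poly_Mapping.single s 1) 1"

definition coeff_scalar ::
    "nat \<Rightarrow> nat \<Rightarrow> (lab_edge set list \<Rightarrow> int) \<Rightarrow> lab_edge set list \<Rightarrow> 'a :: field" where
  "coeff_scalar t k \<epsilon> Q =
     of_int (\<epsilon> Q) * (\<Prod>i<k. det (B_cols t (set (K_edges t) - edge_ends ` (Q ! i))))"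

end

theory Submission
  imports Defs
begin

text \<open>Every bottom row of \<open>M_mat\<close> is a sum of \<open>k\<close> monomial multiples of unit rows, one in each of the
  \<open>k\<close> column blocks. Choosing one summand per row amounts to a colouring \<open>\<phi>\<close> of the edge
  occurrences by the \<open>k\<close> blocks, so by multilinearity the determinant is the sum over all
  colourings of the monomial \<open>\<Prod>f. x (edge_label f) ^ \<phi> f\<close> times the determinant of an integer
  matrix \<open>colour_mat t k fs \<phi>\<close> (lemma \<open>det_M_mat_expansion\<close>). Everything else is a statement about
  these integers.

  Modulo the rows of \<open>B_mat\<close>, which are the triangles through the vertex \<open>t\<close>, the oriented edge
  from \<open>x\<close> to \<open>y\<close> is the difference of the edges from \<open>x\<close> and from \<open>y\<close> to \<open>t\<close>, that is, a potential
  difference. If the edges of a connected graph are set to zero as well, all potentials agree with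
  that of \<open>t\<close>, and every edge becomes zero (\<open>oriented_edges_generated\<close>). Hence, if all colour
  classes are connected, the rows of the colour matrix generate the whole lattice, and its
  determinant is a unit of the integers (\<open>det_colour_mat_unit\<close>). If some colour class is
  disconnected, the coboundary of one of its components gives a nonzero vector orthogonal to all
  rows, and the determinant vanishes (\<open>det_colour_mat_zero\<close>).

  A connected graph on \<open>t\<close> vertices has at least \<open>t - 1\<close> edges. As there are \<open>k * (t - 1)\<close>
  occurrences in all, \<open>k\<close> colour classes that are all connected have exactly \<open>t - 1\<close> edges each
  and are spanning trees. The colourings that survive are therefore the ordered tree decompositions
  (\<open>bij_betw_colour_classes\<close>).

  The same lattice argument, applied to \<open>B_mat\<close> with the columns of a spanning tree deleted, shows
  that the determinants \<open>det (B_cols t _)\<close> are units of the integers too (\<open>det_B_cols_unit\<close>). This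
  makes the scalars nonzero in every characteristic, and it yields the sign: it is the quotient of
  the determinant of the colour matrix by the product of these minors, and the quotient of two
  integer units is their product.

  For the cancellation, two star trees on three vertices, \<open>12, 13\<close> with label \<open>1\<close> and
  \<open>12, 13\<close> with label \<open>2\<close>, have exactly two decompositions into mixed trees. Both carry the monomial
  with exponents \<open>(1, 1)\<close>, and in characteristic two their scalars add up to \<open>1 + 1 = 0\<close>.\<close>

section \<open>Connected graphs and their edge numbers\<close>

definition adjacency :: "('e \<Rightarrow> 'v set) \<Rightarrow> 'e set \<Rightarrow> ('v \<times> 'v) set" where
  "adjacency ends E = {(x, y). \<exists>f\<in>E. ends f = {x, y}}"

lemma sym_adjacency: "sym (adjacency ends E)"
  by (auto simp: sym_def adjacency_def insert_commute)

lemma adjacency_image: "adjacency id (ends ` E) = adjacency ends E"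
  by (auto simp: adjacency_def)

lemma graph_connected_adjacency:
  "graph_connected ends V E \<longleftrightarrow> V \<noteq> {} \<and> (\<forall>u\<in>V. \<forall>v\<in>V. (u, v) \<in> (adjacency ends E)\<^sup>*)"
  by (simp add: graph_connected_def adjacency_def)

text \<open>Every vertex other than a fixed root has an edge to a vertex that is one step closer to the root,
  and an edge is used by at most one vertex in this way, namely its farther end.\<close>

lemma connected_card_edges_ge:
  assumes conn: "graph_connected ends V E" and fin: "finite E"
  shows "card V - 1 \<le> card E"
proof -
  define R where "R = adjacency ends E"
  obtain r where r: "r \<in> V" and reach: "\<And>v. v \<in> V \<Longrightarrow> (r, v) \<in> R\<^sup>*"
    using conn by (auto simp: graph_connected_adjacency R_def)
  define level where "level v = (LEAST n. (r, v) \<in> R ^^ n)" for v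
  have "\<exists>f\<in>E. \<exists>w. ends f = {w, v} \<and> level v = Suc (level w)" if v: "v \<in> V - {r}" for v
  proof -
    from reach[of v] v have "\<exists>n. (r, v) \<in> R ^^ n"
      by (auto simp: rtrancl_power)
    then have lv: "(r, v) \<in> R ^^ level v"
      unfolding level_def by (rule LeastI_ex)
    have "level v \<noteq> 0"
      using lv v by (cases "level v") auto
    then obtain n where n: "level v = Suc n"
      by (cases "level v") auto
    with lv obtain w where w: "(r, w) \<in> R ^^ n" "(w, v) \<in> R"
      by auto
    have "level w \<le> n"
      unfolding level_def by (rule Least_le) (fact w(1))
    have lw: "(r, w) \<in> R ^^ level w"
      unfolding level_def by (rule LeastI) (fact w(1))
    have "(r, v) \<in> R ^^ Suc (level w)"
      using lw w(2) by auto
    then have "level v \<le> Suc (level w)"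
      unfolding level_def by (rule Least_le)
    with \<open>level w \<le> n\<close> n have "level v = Suc (level w)"
      by simp
    with w(2) show ?thesis
      by (auto simp: R_def adjacency_def)
  qed
  then obtain parent_edge where pe: "\<And>v. v \<in> V - {r} \<Longrightarrow>
      parent_edge v \<in> E \<and> (\<exists>w. ends (parent_edge v) = {w, v} \<and> level v = Suc (level w))"
    by metis
  have "inj_on parent_edge (V - {r})"
  proof (rule inj_onI)
    fix v v' assume *: "v \<in> V - {r}" "v' \<in> V - {r}" "parent_edge v = parent_edge v'"
    obtain w where w: "ends (parent_edge v) = {w, v}" "level v = Suc (level w)"
      using pe[OF *(1)] by auto
    obtain w' where w': "ends (parent_edge v') = {w', v'}" "level v' = Suc (level w')"
      using pe[OF *(2)] by auto
    from w(1) w'(1) *(3) have "{w, v} = {w', v'}"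
      by simp
    with w(2) w'(2) show "v = v'"
      by (auto simp: doubleton_eq_iff)
  qed
  moreover have "parent_edge ` (V - {r}) \<subseteq> E"
    using pe by blast
  ultimately have "card (V - {r}) \<le> card E"
    using fin by (metis card_inj_on_le)
  with r show ?thesis
    by simp
qed

text \<open>The rest of the cycle is a detour around the deleted edge.\<close>

lemma connected_minus_cycle_edge:
  assumes conn: "graph_connected ends V E" and cyc: "graph_cycle ends E vs es"
  shows "graph_connected ends V (E - {es ! 0})"
proof -
  define R' where "R' = adjacency ends (E - {es ! 0})"
  define l where "l = length vs"
  from cyc have l2: "l \<ge> 2" and les: "length es = l" and de: "distinct es" and sub: "set es \<subseteq> E"
    and e: "\<And>i. i < l \<Longrightarrow> ends (es ! i) = {vs ! i, vs ! (Suc i mod l)}"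
    by (auto simp: graph_cycle_def l_def)
  have sym': "sym (R'\<^sup>*)"
    unfolding R'_def by (intro sym_rtrancl sym_adjacency)
  have walk: "(vs ! 1, vs ! (Suc i mod l)) \<in> R'\<^sup>*" if "i < l" for i
    using that
  proof (induction i)
    case 0
    with l2 show ?case by simp
  next
    case (Suc i)
    have "es ! Suc i \<in> E - {es ! 0}"
      using Suc.prems sub les de by (auto simp: nth_eq_iff_index_eq)
    moreover have "ends (es ! Suc i) = {vs ! (Suc i mod l), vs ! (Suc (Suc i) mod l)}"
      using e[OF Suc.prems] Suc.prems by simp
    ultimately have "(vs ! (Suc i mod l), vs ! (Suc (Suc i) mod l)) \<in> R'"
      by (auto simp: R'_def adjacency_def)
    with Suc show ?case
      by (meson Suc_lessD rtrancl.rtrancl_into_rtrancl)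
  qed
  have detour: "(vs ! 1, vs ! 0) \<in> R'\<^sup>*"
    using walk[of "l - 1"] l2 by simp
  have "adjacency ends E \<subseteq> R'\<^sup>*"
  proof clarify
    fix x y assume "(x, y) \<in> adjacency ends E"
    then obtain f where f: "f \<in> E" "ends f = {x, y}"
      by (auto simp: adjacency_def)
    show "(x, y) \<in> R'\<^sup>*"
    proof (cases "f = es ! 0")
      case True
      with f e[of 0] l2 have "{x, y} = {vs ! 0, vs ! 1}"
        by simp
      with detour sym' show ?thesis
        by (auto simp: doubleton_eq_iff dest: symD)
    next
      case False
      with f show ?thesis
        by (auto simp: R'_def adjacency_def)
    qed
  qed
  then have "(adjacency ends E)\<^sup>* \<subseteq> R'\<^sup>*"
    by (metis rtrancl_mono rtrancl_idemp)
  with conn show ?thesis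
    by (auto simp: graph_connected_adjacency R'_def)
qed

text \<open>If there were a cycle, one of its edges could be deleted without losing connectedness, which would
  leave too few edges.\<close>

lemma connected_card_imp_tree:
  assumes ends: "\<And>f. f \<in> E \<Longrightarrow> ends f \<subseteq> V \<and> card (ends f) = 2"
    and conn: "graph_connected ends V E" and fin: "finite E" and card: "card E \<le> card V - 1"
  shows "is_tree ends V E"
proof -
  have False if cyc: "graph_cycle ends E vs es" for vs es
  proof -
    have "es ! 0 \<in> E"
      using cyc unfolding graph_cycle_def
      by (metis not_numeral_le_zero nth_mem length_greater_0_conv list.size(3) subsetD)
    moreover have "card V - 1 \<le> card (E - {es ! 0})"
      by (intro connected_card_edges_ge[OF connected_minus_cycle_edge[OF conn cyc]]) (simp add: fin)
    ultimately show False
      using card fin by (metis card_Diff1_less leD le_trans)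
  qed
  with ends conn show ?thesis
    by (auto simp: is_tree_def)
qed

lemma connected_image:
  "graph_connected ends V E \<Longrightarrow> graph_connected id V (ends ` E)"
  by (simp add: graph_connected_adjacency adjacency_image)

section \<open>The triangle matrix\<close>

lemma set_lex_pairs: "set (lex_pairs t) = {(u, v). 1 \<le> u \<and> u < v \<and> v \<le> t}"
proof -
  have "set (lex_pairs t) = (SIGMA u:{1..<t + 1}. {u + 1..<t + 1})"
    by (auto simp: lex_pairs_def simp del: upt_Suc)
  then show ?thesis by auto
qed

lemma distinct_lex_pairs: "distinct (lex_pairs t)"
proof -
  have "distinct (concat (map (\<lambda>u. map (Pair u) [u + 1..<t + 1]) us))" if "distinct us" for us :: "nat list"
    using that by (induction us) (auto simp: distinct_map inj_on_def)
  then show ?thesis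
    by (simp add: lex_pairs_def)
qed

lemma set_K_edges: "set (K_edges t) = {a. a \<subseteq> {1..t} \<and> card a = 2}"
proof -
  have "\<exists>x\<in>set (lex_pairs t). a = (\<lambda>(u, v). {u, v}) x" if a: "a \<subseteq> {1..t}" "card a = 2" for a
  proof -
    from a(2) obtain u v where "a = {u, v}" "u \<noteq> v"
      by (auto simp: card_2_iff)
    then have "a = {min u v, max u v}" "min u v < max u v"
      by (auto simp: min_def max_def)
    moreover have "(min u v, max u v) \<in> set (lex_pairs t)"
      using a(1) \<open>a = {u, v}\<close> \<open>u \<noteq> v\<close> by (auto simp: set_lex_pairs min_def max_def)
    ultimately show ?thesis
      by (metis case_prod_conv)
  qed
  then have "{a. a \<subseteq> {1..t} \<and> card a = 2} \<subseteq> set (K_edges t)"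
    unfolding K_edges_def set_map by blast
  moreover have "set (K_edges t) \<subseteq> {a. a \<subseteq> {1..t} \<and> card a = 2}"
    by (auto simp: K_edges_def set_lex_pairs)
  ultimately show ?thesis by blast
qed

lemma distinct_K_edges: "distinct (K_edges t)"
  unfolding K_edges_def distinct_map
  by (auto simp: distinct_lex_pairs set_lex_pairs inj_on_def doubleton_eq_iff)

lemma length_K_edges: "length (K_edges t) = t choose 2"
proof -
  have "length (K_edges t) = card {a. a \<subseteq> {1..t} \<and> card a = 2}"
    using distinct_card[OF distinct_K_edges] set_K_edges by metis
  then show ?thesis
    using n_subsets[of "{1..t}" 2] by simp
qed

lemma length_lex_pairs: "length (lex_pairs t) = t choose 2"
  using length_K_edges by (simp add: K_edges_def)

lemma K_edges_nth:
  assumes "q < t choose 2"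
  obtains u v where "lex_pairs t ! q = (u, v)" "K_edges t ! q = {u, v}" "1 \<le> u" "u < v" "v \<le> t"
proof -
  obtain u v where uv: "lex_pairs t ! q = (u, v)"
    by fastforce
  then have "(u, v) \<in> set (lex_pairs t)"
    using assms by (metis length_lex_pairs nth_mem)
  then have "1 \<le> u" "u < v" "v \<le> t"
    by (simp_all add: set_lex_pairs)
  moreover have "K_edges t ! q = {u, v}"
    using uv assms by (simp add: K_edges_def length_lex_pairs)
  ultimately show ?thesis
    using uv that by blast
qed

lemma K_edges_index:
  assumes "x \<in> {1..t}" "y \<in> {1..t}" "x \<noteq> y"
  obtains q where "q < t choose 2" "K_edges t ! q = {x, y}"
proof -
  have "{x, y} \<in> set (K_edges t)"
    using assms by (simp add: set_K_edges)
  then show ?thesis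
    using that by (auto simp: in_set_conv_nth length_K_edges)
qed

lemma choose_two_step: "t \<ge> 2 \<Longrightarrow> t choose 2 = ((t - 1) choose 2) + (t - 1)"
  by (cases t) (auto simp: numeral_2_eq_2)

text \<open>The coordinate at \<open>a\<close> of the edge oriented from \<open>x\<close> to \<open>y\<close>, where each pair counts positively
  from its smaller to its larger end; a loop gives the zero vector.\<close>

definition oriented_edge :: "nat \<Rightarrow> nat \<Rightarrow> nat set \<Rightarrow> int" where
  "oriented_edge x y a = (if a = {x, y} then (if x < y then 1 else if y < x then - 1 else 0) else 0)"

lemma oriented_edge_swap: "oriented_edge y x a = - oriented_edge x y a"
  by (auto simp: oriented_edge_def insert_commute)

lemma B_mat_row:
  assumes p: "p < (t - 1) choose 2" and q: "q < t choose 2" and uv: "lex_pairs (t - 1) ! p = (u, v)"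
  shows "(B_mat t :: int mat) $$ (p, q) =
    oriented_edge u v (K_edges t ! q) + oriented_edge v t (K_edges t ! q) - oriented_edge u t (K_edges t ! q)"
proof -
  have "1 \<le> u \<and> u < v \<and> v \<le> t - 1"
    by (rule K_edges_nth[OF p]) (use uv in simp)
  then have "u < v" "u < t" "v < t" and ne: "{u, v} \<noteq> {v, t}" "{u, v} \<noteq> {u, t}" "{v, t} \<noteq> {u, t}"
    by (auto simp: doubleton_eq_iff)
  moreover have "(B_mat t :: int mat) $$ (p, q) = (let a = K_edges t ! q in
      if a = {u, v} \<or> a = {v, t} then 1 else if a = {u, t} then - 1 else 0)"
    using p q uv by (simp add: B_mat_def)
  ultimately show ?thesis
    by (cases "K_edges t ! q = {u, v}"; cases "K_edges t ! q = {v, t}"; cases "K_edges t ! q = {u, t}")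
      (simp_all add: oriented_edge_def Let_def)
qed

text \<open>Entries in \<open>{0, 1, - 1}\<close> come from the integers, and so do all minors. The determinants below are
  computed over the integers, where being a unit pins them down to a sign.\<close>

lemma B_mat_hom: "B_mat t = map_mat of_int (B_mat t :: int mat)"
  by (rule eq_matI) (auto simp: B_mat_def Let_def split: prod.splits)

lemma B_cols_hom: "B_cols t Y = map_mat of_int (B_cols t Y :: int mat)"
proof (rule eq_matI)
  fix p c
  assume "p < dim_row (map_mat of_int (B_cols t Y :: int mat) :: 'a mat)"
    "c < dim_col (map_mat of_int (B_cols t Y :: int mat) :: 'a mat)"
  then have pc: "p < (t - 1) choose 2" "c < card {q. q < t choose 2 \<and> K_edges t ! q \<in> Y}"
    by (auto simp: B_cols_def dim_submatrix B_mat_def)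
  then have "pick {q. q < t choose 2 \<and> K_edges t ! q \<in> Y} c < t choose 2"
    using pick_in_set_le[of c "{q. q < t choose 2 \<and> K_edges t ! q \<in> Y}"] by blast
  with pc show "B_cols t Y $$ (p, c) = (map_mat of_int (B_cols t Y :: int mat) :: 'a mat) $$ (p, c)"
    by (subst B_cols_def, subst B_mat_hom)
      (simp add: B_cols_def submatrix_def B_mat_def pick_UNIV)
qed (auto simp: B_cols_def dim_submatrix B_mat_def)

section \<open>Integer row lattices\<close>

text \<open>Vectors are functions of which only the values below \<open>dim_col A\<close> matter.\<close>

definition row_span :: "int mat \<Rightarrow> (nat \<Rightarrow> int) set" where
  "row_span A = {y. \<exists>w. \<forall>c<dim_col A. y c = (\<Sum>p<dim_row A. w p * A $$ (p, c))}"

lemma row_span_cong: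
  "y \<in> row_span A \<Longrightarrow> (\<And>c. c < dim_col A \<Longrightarrow> z c = y c) \<Longrightarrow> z \<in> row_span A"
  by (auto simp: row_span_def)

lemma row_span_zero: "(\<lambda>_. 0) \<in> row_span A"
  unfolding row_span_def by (auto intro!: exI[of _ "\<lambda>_. 0"])

lemma row_span_diff:
  assumes "y \<in> row_span A" "z \<in> row_span A"
  shows "(\<lambda>c. y c - z c) \<in> row_span A"
proof -
  obtain w w' where "\<forall>c<dim_col A. y c = (\<Sum>p<dim_row A. w p * A $$ (p, c))"
    "\<forall>c<dim_col A. z c = (\<Sum>p<dim_row A. w' p * A $$ (p, c))"
    using assms by (auto simp: row_span_def)
  then show ?thesis
    unfolding row_span_def
    by (intro CollectI exI[of _ "\<lambda>p. w p - w' p"]) (auto simp: left_diff_distrib sum_subtractf)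
qed

lemma row_span_uminus: "y \<in> row_span A \<Longrightarrow> (\<lambda>c. - y c) \<in> row_span A"
  using row_span_diff[OF row_span_zero] by simp

lemma row_span_add:
  "y \<in> row_span A \<Longrightarrow> z \<in> row_span A \<Longrightarrow> (\<lambda>c. y c + z c) \<in> row_span A"
  using row_span_diff[OF _ row_span_uminus] by fastforce

lemma row_in_row_span:
  assumes "p < dim_row A" shows "(\<lambda>c. A $$ (p, c)) \<in> row_span A"
  unfolding row_span_def
  using assms by (intro CollectI exI[of _ "\<lambda>p'. if p' = p then 1 else 0"]) (simp add: if_distrib[of "\<lambda>x. x * _"] cong: if_cong)

text \<open>The coefficients that express the unit vectors by the rows of \<open>A\<close> form a left inverse of \<open>A\<close> over
  the integers.\<close>

lemma det_unit_if_rows_generate: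
  assumes A: "A \<in> carrier_mat n n"
    and gen: "\<And>c. c < n \<Longrightarrow> (\<lambda>c'. if c' = c then 1 else 0) \<in> row_span A"
  shows "det A \<in> {1, - 1}"
proof -
  from gen have "\<forall>c. \<exists>w. c < n \<longrightarrow> (\<forall>c'<n. (if c' = c then 1 else 0) = (\<Sum>p<n. w p * A $$ (p, c')))"
    using A unfolding row_span_def by auto
  from choice[OF this] obtain w where w: "\<And>c c'. c < n \<Longrightarrow> c' < n \<Longrightarrow>
      (if c' = c then 1 else 0) = (\<Sum>p<n. w c p * A $$ (p, c'))"
    by blast
  define L where "L = mat n n (\<lambda>(c, p). w c p)"
  have L: "L \<in> carrier_mat n n"
    by (simp add: L_def)
  have "L * A = 1\<^sub>m n"
  proof (rule eq_matI)
    fix c c' assume "c < dim_row (1\<^sub>m n :: int mat)" "c' < dim_col (1\<^sub>m n :: int mat)"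
    then show "(L * A) $$ (c, c') = 1\<^sub>m n $$ (c, c')"
      using A w[of c c'] by (auto simp: L_def scalar_prod_def lessThan_atLeast0)
  qed (use A L in auto)
  then have "det L * det A = 1"
    using det_mult[OF L A] by simp
  then show ?thesis
    using zmult_eq_1_iff by blast
qed

text \<open>Think of \<open>d x y\<close> as the vector of the oriented edge from \<open>x\<close> to \<open>y\<close>, and of \<open>d x t\<close> as the potential
  of \<open>x\<close>. The triangles through \<open>t\<close> say that \<open>d x y\<close> is a potential difference modulo the lattice;
  the edges of \<open>Q\<close> say that the potential does not change along them, so by connectedness it is
  constant. The family \<open>d\<close> is left open because it is used both for the blocks of a colour matrix,
  where the edges of \<open>Q\<close> are rows, and for \<open>B_cols\<close>, where the edges of \<open>Q\<close> are deleted columns and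
  hence zero.\<close>

lemma oriented_edges_generated:
  fixes d :: "nat \<Rightarrow> nat \<Rightarrow> nat \<Rightarrow> int"
  assumes conn: "graph_connected ends {1..t} Q" 
    and swap: "\<And>x y c. d y x c = - d x y c"
    and triangle: "\<And>u v. 1 \<le> u \<Longrightarrow> u < v \<Longrightarrow> v < t \<Longrightarrow> (\<lambda>c. d u v c + d v t c - d u t c) \<in> row_span A"
    and edge: "\<And>f x y. f \<in> Q \<Longrightarrow> ends f = {x, y} \<Longrightarrow> x \<in> {1..t} \<Longrightarrow> y \<in> {1..t} \<Longrightarrow> d x y \<in> row_span A"
    and ends: "\<And>f. f \<in> Q \<Longrightarrow> ends f \<subseteq> {1..t}"
    and xy: "x \<in> {1..t}" "y \<in> {1..t}"
  shows "d x y \<in> row_span A"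
proof -
  have refl: "d x x c = 0" for x c
    using swap[of x x c] by simp
  have tri: "(\<lambda>c. d x y c + d y t c - d x t c) \<in> row_span A" if "x \<in> {1..t}" "y \<in> {1..t}" for x y
  proof -
    have "x \<le> t" "y \<le> t"
      using that by auto
    then consider "x < y \<and> y < t" | "y < x \<and> x < t" | "x = y \<or> x = t \<or> y = t"
      by linarith
    then show ?thesis
    proof cases
      case 1
      with that triangle[of x y] show ?thesis by auto
    next
      case 2
      then have "(\<lambda>c. - (d y x c + d x t c - d y t c)) \<in> row_span A"
        using that by (intro row_span_uminus triangle) auto
      then show ?thesis
        by (rule row_span_cong) (simp add: swap[of x y])
    next
      case 3
      then show ?thesis
        by (intro row_span_cong[OF row_span_zero]) (auto simp: refl swap[of t y])
    qed
  qed
  have difference: "(\<lambda>c. d x t c - d y t c) \<in> row_span A" if adj: "(x, y) \<in> adjacency ends Q" for x y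
  proof -
    obtain f where f: "f \<in> Q" "ends f = {x, y}"
      using adj by (auto simp: adjacency_def)
    with ends have xy: "x \<in> {1..t}" "y \<in> {1..t}" by blast+
    have "(\<lambda>c. d x y c - (d x y c + d y t c - d x t c)) \<in> row_span A"
      by (intro row_span_diff edge[OF f xy] tri xy)
    then show ?thesis by simp
  qed
  have "(x, y) \<in> (adjacency ends Q)\<^sup>*"
    using conn xy by (auto simp: graph_connected_adjacency)
  then have "(\<lambda>c. d x t c - d y t c) \<in> row_span A"
  proof induction
    case base
    show ?case by (simp add: row_span_zero)
  next
    case (step y z)
    from row_span_add[OF step.IH difference[OF step.hyps(2)]]
    show ?case by simp
  qed
  from row_span_add[OF tri[OF xy] this] show ?thesis
    by (rule row_span_cong) simp
qed

lemma lex_pairs_index: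
  assumes "1 \<le> u" "u < v" "v < t"
  obtains p where "p < (t - 1) choose 2" "lex_pairs (t - 1) ! p = (u, v)"
proof -
  have "(u, v) \<in> set (lex_pairs (t - 1))"
    using assms by (simp add: set_lex_pairs)
  then show ?thesis
    using that by (auto simp: in_set_conv_nth length_lex_pairs)
qed

section \<open>Minors complementary to spanning trees\<close>

text \<open>Deleting the columns of \<open>Q\<close> amounts to setting its edges to zero; the remaining edges are then
  generated by the triangles because \<open>Q\<close> is connected. The number of endpoint pairs makes the matrix
  square.\<close>

lemma det_B_cols_unit:
  assumes t: "t \<ge> 2" and conn: "graph_connected ends {1..t} Q"
    and ends: "\<And>f. f \<in> Q \<Longrightarrow> ends f \<subseteq> {1..t} \<and> card (ends f) = 2"
    and card: "card (ends ` Q) = t - 1"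
  shows "det (B_cols t (set (K_edges t) - ends ` Q) :: int mat) \<in> {1, - 1}"
proof -
  define J where "J = {q. q < t choose 2 \<and> K_edges t ! q \<in> set (K_edges t) - ends ` Q}"
  define r where "r = (t - 1) choose 2"
  define A where "A = (B_cols t (set (K_edges t) - ends ` Q) :: int mat)"
  \<comment> \<open>the oriented edges restricted to the columns that survive\<close>
  define d where "d x y c = oriented_edge x y (K_edges t ! pick J c)" for x y c
  have sub: "ends ` Q \<subseteq> set (K_edges t)"
    using ends by (auto simp: set_K_edges)
  have "inj_on ((!) (K_edges t)) J"
    using inj_on_nth[OF distinct_K_edges] by (auto simp: J_def length_K_edges)
  moreover have "(!) (K_edges t) ` J = set (K_edges t) - ends ` Q"
  proof (intro equalityI subsetI)
    fix a assume "a \<in> set (K_edges t) - ends ` Q"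
    moreover from this obtain q where "q < t choose 2" "K_edges t ! q = a"
      by (auto simp: in_set_conv_nth length_K_edges)
    ultimately show "a \<in> (!) (K_edges t) ` J"
      by (intro image_eqI[of _ _ q]) (auto simp: J_def)
  qed (auto simp: J_def)
  ultimately have "card J = card (set (K_edges t) - ends ` Q)"
    using card_image by fastforce
  also have "\<dots> = (t choose 2) - (t - 1)"
    using sub card distinct_card[OF distinct_K_edges, of t]
    by (simp add: card_Diff_subset finite_subset[OF sub] length_K_edges)
  finally have card_J: "card J = r"
    using choose_two_step[OF t] by (simp add: r_def)
  have J_eq: "{j. j < t choose 2 \<and> j \<in> J} = J"
    by (auto simp: J_def)
  have A_sub: "A = submatrix (B_mat t) UNIV J"
    by (simp only: A_def B_cols_def J_def)
  have A: "A \<in> carrier_mat r r"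
    using card_J J_eq by (intro carrier_matI) (simp_all add: A_sub dim_submatrix B_mat_def r_def)
  have entry: "A $$ (p, c) = B_mat t $$ (p, pick J c)" if "p < r" "c < r" for p c
    using that card_J J_eq
    by (simp add: A_sub submatrix_def B_mat_def r_def pick_UNIV)
  have pick: "pick J c \<in> J" if "c < r" for c
    using that card_J by (simp add: pick_in_set_le)
  then have pick_lt: "pick J c < t choose 2" if "c < r" for c
    using that by (auto simp: J_def)
  have gen: "d x y \<in> row_span A" if "x \<in> {1..t}" "y \<in> {1..t}" for x y
  proof (rule oriented_edges_generated[OF conn _ _ _ _ that])
    show "d y x c = - d x y c" for x y c
      by (simp add: d_def oriented_edge_swap[of x y])
  next
    fix u v assume uv: "1 \<le> u" "u < v" "v < t"
    then obtain p where p: "p < r" "lex_pairs (t - 1) ! p = (u, v)"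
      by (metis lex_pairs_index r_def)
    then show "(\<lambda>c. d u v c + d v t c - d u t c) \<in> row_span A"
      using A B_mat_row[of p t, OF _ pick_lt]
      by (intro row_span_cong[OF row_in_row_span[of p A]]) (auto simp: entry d_def r_def)
  next
    fix f x y assume "f \<in> Q" "ends f = {x, y}"
    then have "d x y c = 0" if "c < r" for c
      using pick[OF that] by (auto simp: d_def J_def oriented_edge_def image_iff)
    then show "d x y \<in> row_span A"
      using A by (intro row_span_cong[OF row_span_zero]) auto
  qed (use ends in auto)
  have "det A \<in> {1, - 1}"
  proof (rule det_unit_if_rows_generate[OF A])
    fix c assume c: "c < r"
    obtain u v where uv: "K_edges t ! pick J c = {u, v}" "1 \<le> u" "u < v" "v \<le> t"
      using K_edges_nth[OF pick_lt[OF c]] by metis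
    have "d u v \<in> row_span A"
      using uv by (intro gen) auto
    then show "(\<lambda>c'. if c' = c then 1 else 0) \<in> row_span A"
    proof (rule row_span_cong)
      fix c' assume "c' < dim_col A"
      then have c': "c' < r"
        using A by simp
      have "K_edges t ! pick J c' = {u, v} \<longleftrightarrow> pick J c' = pick J c"
        using nth_eq_iff_index_eq[OF distinct_K_edges, of "pick J c'" t "pick J c"] pick_lt[OF c] pick_lt[OF c'] uv(1)
        by (simp add: length_K_edges)
      also have "\<dots> \<longleftrightarrow> c' = c"
        using pick_mono_le[of c' J c] pick_mono_le[of c J c'] c c' card_J by (metis linorder_neqE_nat less_irrefl)
      finally show "(if c' = c then 1 else 0) = d u v c'"
        using uv by (auto simp: d_def oriented_edge_def)
    qed
  qed
  then show ?thesis
    by (simp add: A_def)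
qed

section \<open>The matrix of a colouring\<close>

text \<open>The matrix \<open>M_mat\<close> with the bottom row of each occurrence \<open>f\<close> replaced by the unit row in the
  column of block \<open>\<phi> f\<close> that belongs to the endpoint pair of \<open>f\<close>.\<close>

definition colour_mat :: "nat \<Rightarrow> nat \<Rightarrow> lab_edge list \<Rightarrow> (lab_edge \<Rightarrow> nat) \<Rightarrow> int mat" where
  "colour_mat t k fs \<phi> =
     (let m = t choose 2; r = (t - 1) choose 2 in
      mat (k * r + length fs) (k * m) (\<lambda>(p, c).
        if p < k * r then (if p div r = c div m then B_mat t $$ (p mod r, c mod m) else 0)
        else (let f = fs ! (p - k * r) in
              if c div m = \<phi> f \<and> edge_ends f = K_edges t ! (c mod m) then 1 else 0)))"

definition block_edge :: "nat \<Rightarrow> nat \<Rightarrow> nat \<Rightarrow> nat \<Rightarrow> nat \<Rightarrow> int" where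
  "block_edge t i x y c =
     (if c div (t choose 2) = i then oriented_edge x y (K_edges t ! (c mod (t choose 2))) else 0)"

lemma block_edge_swap: "block_edge t i y x c = - block_edge t i x y c"
  by (simp add: block_edge_def oriented_edge_swap[of x y])

lemma block_index_lt: "i < k \<Longrightarrow> q < m \<Longrightarrow> i * m + q < k * (m :: nat)"
proof -
  assume "i < k" "q < m"
  then have "i * m + q < Suc i * m" "Suc i * m \<le> k * m"
    by (simp, intro mult_le_mono1, simp)
  then show ?thesis by (rule less_le_trans)
qed

lemma colour_mat_dims:
  assumes "t \<ge> 2" and "length fs = k * (t - 1)"
  shows "colour_mat t k fs \<phi> \<in> carrier_mat (k * (t choose 2)) (k * (t choose 2))"
    and "k * ((t - 1) choose 2) + length fs = k * (t choose 2)"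
  using assms choose_two_step[OF assms(1)] by (auto simp: colour_mat_def Let_def algebra_simps)

lemma choose_two_pos: "t \<ge> 2 \<Longrightarrow> 0 < t choose 2"
  by simp

lemma colour_mat_top_row:
  assumes t: "t \<ge> 2" and p: "p < k * ((t - 1) choose 2)" and c: "c < k * (t choose 2)"
    and uv: "lex_pairs (t - 1) ! (p mod ((t - 1) choose 2)) = (u, v)"
  shows "colour_mat t k fs \<phi> $$ (p, c) = block_edge t (p div ((t - 1) choose 2)) u v c
    + block_edge t (p div ((t - 1) choose 2)) v t c - block_edge t (p div ((t - 1) choose 2)) u t c"
proof -
  have "p mod ((t - 1) choose 2) < (t - 1) choose 2"
    using p by (metis mod_less_divisor mult_0_right not_gr_zero not_less_zero)
  moreover have "c mod (t choose 2) < t choose 2"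
    using choose_two_pos[OF t] by simp
  ultimately show ?thesis
    using p c B_mat_row[OF _ _ uv] by (auto simp: colour_mat_def Let_def block_edge_def)
qed

lemma colour_mat_bottom_row:
  assumes j: "j < length fs" and c: "c < k * (t choose 2)"
    and xy: "edge_ends (fs ! j) = {x, y}" "x < y"
  shows "colour_mat t k fs \<phi> $$ (k * ((t - 1) choose 2) + j, c) = block_edge t (\<phi> (fs ! j)) x y c"
  using assms by (auto simp: colour_mat_def Let_def block_edge_def oriented_edge_def)

lemma card_2_ordered:
  assumes "card a = 2" obtains x y :: nat where "a = {x, y}" "x < y"
  using assms by (metis card_2_iff insert_commute linorder_neqE_nat)

lemma det_colour_mat_unit:
  assumes t: "t \<ge> 2" and len: "length fs = k * (t - 1)"
    and ends: "\<And>f. f \<in> set fs \<Longrightarrow> edge_ends f \<subseteq> {1..t} \<and> card (edge_ends f) = 2"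
    and conn: "\<And>i. i < k \<Longrightarrow> graph_connected edge_ends {1..t} {f \<in> set fs. \<phi> f = i}"
  shows "det (colour_mat t k fs \<phi>) \<in> {1, - 1}"
proof -
  define m where "m = t choose 2"
  define r where "r = (t - 1) choose 2"
  define A where "A = colour_mat t k fs \<phi>"
  have A: "A \<in> carrier_mat (k * m) (k * m)" and dims: "k * r + length fs = k * m"
    using colour_mat_dims[OF t len] by (auto simp: A_def m_def r_def)
  have m: "0 < m"
    using choose_two_pos[OF t] by (simp add: m_def)
  have gen: "block_edge t i x y \<in> row_span A" if i: "i < k" and xy: "x \<in> {1..t}" "y \<in> {1..t}" for i x y
  proof (rule oriented_edges_generated[OF conn[OF i] block_edge_swap _ _ _ xy])
    fix u v assume uv: "1 \<le> u" "u < v" "v < t"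
    then obtain p0 where p0: "p0 < r" "lex_pairs (t - 1) ! p0 = (u, v)"
      by (metis lex_pairs_index r_def)
    define p where "p = i * r + p0"
    have p: "p < k * r" "p div r = i" "p mod r = p0"
      using p0 block_index_lt[OF i] by (auto simp: p_def)
    then show "(\<lambda>c. block_edge t i u v c + block_edge t i v t c - block_edge t i u t c) \<in> row_span A"
      using A dims colour_mat_top_row[OF t, of p k _ u v fs \<phi>] p0
      by (intro row_span_cong[OF row_in_row_span[of p A]]) (auto simp: A_def m_def r_def)
  next
    fix f x y assume f: "f \<in> {f \<in> set fs. \<phi> f = i}" "edge_ends f = {x, y}"
    have edge: "block_edge t i x y \<in> row_span A" if "edge_ends f = {x, y}" "x < y" for x y
    proof -
      obtain j where j: "j < length fs" "fs ! j = f"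
        using f by (auto simp: in_set_conv_nth)
      show ?thesis
        using A dims j f colour_mat_bottom_row[of j fs _ k t x y \<phi>] that
        by (intro row_span_cong[OF row_in_row_span[of "k * r + j" A]]) (auto simp: A_def m_def r_def)
    qed
    have "x \<noteq> y"
      using ends[of f] f by auto
    then consider "x < y" | "y < x"
      by linarith
    then show "block_edge t i x y \<in> row_span A"
    proof cases
      case 1
      with edge f show ?thesis by blast
    next
      case 2
      then have "block_edge t i y x \<in> row_span A"
        using edge[of y x] f by (simp add: insert_commute)
      from row_span_uminus[OF this] show ?thesis
        by (simp add: block_edge_swap[of t i y x])
    qed
  qed (use ends in auto)
  have "det A \<in> {1, - 1}"
  proof (rule det_unit_if_rows_generate[OF A])
    fix c assume c: "c < k * m"
    have i: "c div m < k" and q: "c mod m < m"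
      using c m by (simp_all add: less_mult_imp_div_less)
    obtain u v where uv: "K_edges t ! (c mod m) = {u, v}" "1 \<le> u" "u < v" "v \<le> t"
      using K_edges_nth[of "c mod m" t] q by (metis m_def)
    have "block_edge t (c div m) u v \<in> row_span A"
      using uv by (intro gen i) auto
    then show "(\<lambda>c'. if c' = c then 1 else 0) \<in> row_span A"
    proof (rule row_span_cong)
      fix c' assume "c' < dim_col A"
      have "K_edges t ! (c' mod m) = {u, v} \<longleftrightarrow> c' mod m = c mod m"
        using nth_eq_iff_index_eq[OF distinct_K_edges, of "c' mod m" t "c mod m"] q uv(1) m
        by (simp add: length_K_edges m_def)
      then have "c' = c \<longleftrightarrow> c' div m = c div m \<and> K_edges t ! (c' mod m) = {u, v}"
        by (metis div_mult_mod_eq)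
      then show "(if c' = c then 1 else 0) = block_edge t (c div m) u v c'"
        using uv by (auto simp: block_edge_def oriented_edge_def m_def)
    qed
  qed
  then show ?thesis
    by (simp add: A_def)
qed

text \<open>On the block of colour \<open>j\<close> let \<open>h j\<close> be the indicator of the vertices reachable from \<open>a\<close> by edges
  of that colour. Its coboundary \<open>z\<close> is orthogonal to the triangles, because the differences around a
  triangle cancel, and to every bottom row, because \<open>h j\<close> is constant along
  edges of colour \<open>j\<close>. It is not zero, because \<open>a\<close> and \<open>b\<close> lie in different components of colour \<open>i\<close>.\<close>

lemma det_colour_mat_zero:
  assumes t: "t \<ge> 2" and len: "length fs = k * (t - 1)"
    and ends: "\<And>f. f \<in> set fs \<Longrightarrow> edge_ends f \<subseteq> {1..t} \<and> card (edge_ends f) = 2"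
    and phi: "\<And>f. f \<in> set fs \<Longrightarrow> \<phi> f < k"
    and i: "i < k" and disconn: "\<not> graph_connected edge_ends {1..t} {f \<in> set fs. \<phi> f = i}"
  shows "det (colour_mat t k fs \<phi>) = 0"
proof -
  define m where "m = t choose 2"
  define r where "r = (t - 1) choose 2"
  define A where "A = colour_mat t k fs \<phi>"
  have A: "A \<in> carrier_mat (k * m) (k * m)" and dims: "k * r + length fs = k * m"
    using colour_mat_dims[OF t len] by (auto simp: A_def m_def r_def)
  have m: "0 < m"
    using choose_two_pos[OF t] by (simp add: m_def)
  obtain a b where ab: "a \<in> {1..t}" "b \<in> {1..t}"
    "(a, b) \<notin> (adjacency edge_ends {f \<in> set fs. \<phi> f = i})\<^sup>*"
    using disconn t by (auto simp: graph_connected_adjacency)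
  define h :: "nat \<Rightarrow> nat \<Rightarrow> int" where
    "h j w = of_bool ((a, w) \<in> (adjacency edge_ends {f \<in> set fs. \<phi> f = j})\<^sup>*)" for j w
  have h_edge: "h (\<phi> f) x = h (\<phi> f) y" if f: "f \<in> set fs" "edge_ends f = {x, y}" for f x y
  proof -
    have xy: "(x, y) \<in> adjacency edge_ends {g \<in> set fs. \<phi> g = \<phi> f}"
      unfolding adjacency_def using f by blast
    then have yx: "(y, x) \<in> adjacency edge_ends {g \<in> set fs. \<phi> g = \<phi> f}"
      by (rule symD[OF sym_adjacency])
    have "(a, x) \<in> (adjacency edge_ends {g \<in> set fs. \<phi> g = \<phi> f})\<^sup>* \<longleftrightarrow>
        (a, y) \<in> (adjacency edge_ends {g \<in> set fs. \<phi> g = \<phi> f})\<^sup>*"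
      using rtrancl_into_rtrancl[OF _ xy] rtrancl_into_rtrancl[OF _ yx] by blast
    then show ?thesis
      by (simp add: h_def)
  qed
  define z :: "nat \<Rightarrow> int" where
    "z c = h (c div m) (fst (lex_pairs t ! (c mod m))) - h (c div m) (snd (lex_pairs t ! (c mod m)))" for c
  have pairing: "(\<Sum>c<k * m. block_edge t j x y c * z c) = h j x - h j y"
    if j: "j < k" and xy: "x \<in> {1..t}" "y \<in> {1..t}" "x < y" for j x y
  proof -
    obtain q where q: "q < m" "K_edges t ! q = {x, y}"
      using K_edges_index[of x t y] xy by (auto simp: m_def)
    obtain u v where uv: "lex_pairs t ! q = (u, v)" "K_edges t ! q = {u, v}" "u < v"
      using K_edges_nth[of q t] q by (metis m_def)
    then have lex: "lex_pairs t ! q = (x, y)"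
      using q xy by (auto simp: doubleton_eq_iff)
    have "block_edge t j x y c * z c = (if c = j * m + q then h j x - h j y else 0)" for c
    proof -
      have same: "K_edges t ! (c mod m) = {x, y} \<longleftrightarrow> c mod m = q"
        using nth_eq_iff_index_eq[OF distinct_K_edges, of "c mod m" t q] q m
        by (simp add: length_K_edges m_def)
      show ?thesis
      proof (cases "c = j * m + q")
        case True
        with q(1) have "c div m = j" "c mod m = q" by simp_all
        with q xy lex True show ?thesis
          by (simp add: block_edge_def oriented_edge_def m_def[symmetric] z_def)
      next
        case False
        then have "\<not> (c div m = j \<and> K_edges t ! (c mod m) = {x, y})"
          using same div_mult_mod_eq[of c m] by metis
        with False show ?thesis
          by (simp add: block_edge_def oriented_edge_def m_def[symmetric])
      qed
    qed
    then show ?thesis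
      using block_index_lt[OF j q(1)] by simp
  qed
  have row: "(\<Sum>c<k * m. A $$ (p, c) * z c) = 0" if p: "p < k * m" for p
  proof (cases "p < k * r")
    case True
    then have r: "p mod r < r" and j: "p div r < k"
      by (metis mod_less_divisor mult_0_right not_gr_zero not_less_zero, simp add: less_mult_imp_div_less)
    obtain u v where uv: "lex_pairs (t - 1) ! (p mod r) = (u, v)" "1 \<le> u" "u < v" "v \<le> t - 1"
      using K_edges_nth[of "p mod r" "t - 1"] r by (metis r_def)
    have "A $$ (p, c) * z c = block_edge t (p div r) u v c * z c
       + block_edge t (p div r) v t c * z c - block_edge t (p div r) u t c * z c" if "c < k * m" for c
      using colour_mat_top_row[OF t, of p k c u v fs \<phi>] True uv(1) that
      by (simp add: A_def m_def r_def distrib_right left_diff_distrib)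
    then have "(\<Sum>c<k * m. A $$ (p, c) * z c) = (\<Sum>c<k * m. block_edge t (p div r) u v c * z c)
       + (\<Sum>c<k * m. block_edge t (p div r) v t c * z c) - (\<Sum>c<k * m. block_edge t (p div r) u t c * z c)"
      by (simp add: sum.distrib sum_subtractf)
    also have "\<dots> = 0"
      using uv t by (subst (1 2 3) pairing[OF j]) auto
    finally show ?thesis .
  next
    case False
    define j where "j = p - k * r"
    have j: "j < length fs" "p = k * r + j"
      using False p dims by (auto simp: j_def)
    obtain x y where xy: "edge_ends (fs ! j) = {x, y}" "x < y"
      using ends[of "fs ! j"] j card_2_ordered by (metis nth_mem)
    have "(\<Sum>c<k * m. A $$ (p, c) * z c) = (\<Sum>c<k * m. block_edge t (\<phi> (fs ! j)) x y c * z c)"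
      using colour_mat_bottom_row[OF j(1) _ xy, of _ k t \<phi>] by (simp add: A_def m_def r_def j(2))
    also have "\<dots> = h (\<phi> (fs ! j)) x - h (\<phi> (fs ! j)) y"
      using ends[of "fs ! j"] phi[of "fs ! j"] xy j by (intro pairing) auto
    also have "\<dots> = 0"
      using h_edge[of "fs ! j" x y] xy j by simp
    finally show ?thesis .
  qed
  have "A *\<^sub>v vec (k * m) z = 0\<^sub>v (k * m)"
    using A row by (intro eq_vecI) (auto simp: scalar_prod_def lessThan_atLeast0)
  moreover have "vec (k * m) z \<noteq> 0\<^sub>v (k * m)"
  proof
    assume zero: "vec (k * m) z = 0\<^sub>v (k * m)"
    have "z c = 0" if "c < k * m" for c
      using arg_cong[OF zero, of "\<lambda>v. v $ c"] that by simp
    then have "h i (min a b) - h i (max a b) = 0" if "a \<noteq> b"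
      using pairing[OF i, of "min a b" "max a b"] ab that by (auto simp: min_def max_def split: if_splits)
    then have "h i a = h i b"
      by (cases "a = b"; cases "a \<le> b") (auto simp: min_def max_def)
    with ab show False
      by (simp add: h_def)
  qed
  ultimately show ?thesis
    using det_0_iff_vec_prod_zero[OF A] vec_carrier[of "k * m" z] unfolding A_def by blast
qed

section \<open>Expansion over colourings\<close>

lemma prod_lessThan_add:
  "(\<Prod>p<a + b. g p) = (\<Prod>p<a. g p) * (\<Prod>j<b. g (a + j :: nat) :: 'a :: comm_monoid_mult)"
  by (induction b) (simp_all add: mult.assoc)

lemma prod_set_nth:
  assumes "distinct fs"
  shows "(\<Prod>j<length fs. g j) = (\<Prod>f\<in>set fs. g (the_inv_into {..<length fs} ((!) fs) f))"
proof -
  have bij: "bij_betw ((!) fs) {..<length fs} (set fs)"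
    using assms by (simp add: bij_betw_nth)
  have "(\<Prod>f\<in>set fs. g (the_inv_into {..<length fs} ((!) fs) f))
      = (\<Prod>j<length fs. g (the_inv_into {..<length fs} ((!) fs) (fs ! j)))"
    by (rule prod.reindex_bij_betw[OF bij, symmetric])
  also have "\<dots> = (\<Prod>j<length fs. g j)"
    using bij by (intro prod.cong refl arg_cong[of _ _ g] the_inv_into_f_f) (auto simp: bij_betw_def)
  finally show ?thesis ..
qed

text \<open>In the Leibniz formula each factor from a bottom row is a sum over the blocks, and the product of
  these sums is a sum over colourings. For a fixed colouring the remaining terms are the Leibniz
  formula of its colour matrix.\<close>

lemma det_M_mat_expansion:
  fixes x :: "nat \<Rightarrow> 'b :: comm_ring_1"
  assumes t: "t \<ge> 2" and dist: "distinct fs" and len: "length fs = k * (t - 1)"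
  shows "det (M_mat t k fs x) = (\<Sum>\<phi> \<in> set fs \<rightarrow>\<^sub>E {..<k}.
    (\<Prod>f\<in>set fs. x (edge_label f) ^ \<phi> f) * of_int (det (colour_mat t k fs \<phi>)))"
proof -
  define m where "m = t choose 2"
  define r where "r = (t - 1) choose 2"
  define n where "n = k * m"
  define M where "M = M_mat t k fs x"
  define N :: "(lab_edge \<Rightarrow> nat) \<Rightarrow> 'b mat" where "N \<phi> = map_mat of_int (colour_mat t k fs \<phi>)" for \<phi>
  define idx where "idx = the_inv_into {..<length fs} ((!) fs)"
  \<comment> \<open>row \<open>f\<close> of the colour matrix of any colouring with \<open>\<phi> f = i\<close>\<close>
  define b :: "nat \<Rightarrow> lab_edge \<Rightarrow> nat \<Rightarrow> 'b" where
    "b i f c = (if c div m = i \<and> edge_ends f = K_edges t ! (c mod m) then 1 else 0)" for i f c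
  have n: "k * r + length fs = n"
    using colour_mat_dims(2)[OF t len] by (simp add: n_def m_def r_def)
  have N: "N \<phi> \<in> carrier_mat n n" for \<phi>
    using colour_mat_dims(1)[OF t len, of \<phi>] by (simp add: N_def n_def m_def)
  have M: "M \<in> carrier_mat n n"
    using n by (simp add: M_def M_mat_def Let_def n_def m_def r_def)
  have top: "M $$ (p, c) = N \<phi> $$ (p, c)" if "p < k * r" "c < n" for p c \<phi>
  proof -
    have "(of_int (B_mat t $$ (p mod r, c mod m)) :: 'b) = B_mat t $$ (p mod r, c mod m)"
    proof -
      have "p mod r < r" "c mod m < m"
        using that by (auto simp: n_def intro!: mod_less_divisor gr0I)
      then show ?thesis
        by (subst (2) B_mat_hom) (simp add: B_mat_def r_def m_def)
    qed
    with that n show ?thesis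
      by (simp add: M_def N_def M_mat_def colour_mat_def Let_def n_def m_def r_def)
  qed
  have N_bottom: "N \<phi> $$ (k * r + j, c) = b (\<phi> (fs ! j)) (fs ! j) c" if "j < length fs" "c < n" for j c \<phi>
    using that n by (auto simp: N_def colour_mat_def Let_def n_def m_def r_def b_def)
  have M_bottom: "M $$ (k * r + j, c) = (\<Sum>i<k. x (edge_label (fs ! j)) ^ i * b i (fs ! j) c)"
    if "j < length fs" "c < n" for j c
  proof -
    have "c div m < k"
      using that by (simp add: n_def less_mult_imp_div_less)
    then have "(\<Sum>i<k. x (edge_label (fs ! j)) ^ i * b i (fs ! j) c)
        = x (edge_label (fs ! j)) ^ (c div m) * b (c div m) (fs ! j) c"
      by (subst sum.remove[of _ "c div m"]) (auto simp: b_def intro!: sum.neutral)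
    then show ?thesis
      using that n by (simp add: M_def M_mat_def Let_def n_def m_def r_def b_def)
  qed
  have perm_term: "(\<Prod>p = 0..<n. M $$ (p, \<pi> p)) = (\<Sum>\<phi> \<in> set fs \<rightarrow>\<^sub>E {..<k}.
      (\<Prod>f\<in>set fs. x (edge_label f) ^ \<phi> f) * (\<Prod>p = 0..<n. N \<phi> $$ (p, \<pi> p)))"
    if "\<pi> permutes {0..<n}" for \<pi>
  proof -
    have \<pi>: "\<pi> p < n" if "p < n" for p
      using permutes_in_image[OF \<open>\<pi> permutes {0..<n}\<close>, of p] that by simp
    have idx: "idx f < length fs" "fs ! idx f = f" if "f \<in> set fs" for f
    proof -
      have "bij_betw ((!) fs) {..<length fs} (set fs)"
        using dist by (simp add: bij_betw_nth)
      with that show "idx f < length fs" "fs ! idx f = f"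
        unfolding idx_def
        by (metis bij_betw_def lessThan_iff order_refl the_inv_into_into)
          (metis \<open>bij_betw ((!) fs) {..<length fs} (set fs)\<close> bij_betw_def f_the_inv_into_f that)
    qed
    define T where "T = (\<Prod>p<k * r. M $$ (p, \<pi> p))"
    define c where "c f = \<pi> (k * r + idx f)" for f
    have "(\<Prod>p = 0..<n. M $$ (p, \<pi> p)) = T * (\<Prod>j<length fs. M $$ (k * r + j, \<pi> (k * r + j)))"
      by (simp add: T_def n[symmetric] prod_lessThan_add flip: lessThan_atLeast0)
    also have "(\<Prod>j<length fs. M $$ (k * r + j, \<pi> (k * r + j)))
        = (\<Prod>f\<in>set fs. \<Sum>i<k. x (edge_label f) ^ i * b i f (c f))"
      using \<pi> n idx
      by (subst prod_set_nth[OF dist]) (auto simp: M_bottom c_def simp flip: idx_def intro!: prod.cong)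
    also have "\<dots> = (\<Sum>\<phi> \<in> set fs \<rightarrow>\<^sub>E {..<k}. \<Prod>f\<in>set fs. x (edge_label f) ^ \<phi> f * b (\<phi> f) f (c f))"
      by (rule prod_sum_PiE) auto
    also have "T * \<dots> = (\<Sum>\<phi> \<in> set fs \<rightarrow>\<^sub>E {..<k}.
      (\<Prod>f\<in>set fs. x (edge_label f) ^ \<phi> f) * (T * (\<Prod>f\<in>set fs. b (\<phi> f) f (c f))))"
      by (simp add: sum_distrib_left prod.distrib mult_ac)
    also have "\<dots> = (\<Sum>\<phi> \<in> set fs \<rightarrow>\<^sub>E {..<k}.
      (\<Prod>f\<in>set fs. x (edge_label f) ^ \<phi> f) * (\<Prod>p = 0..<n. N \<phi> $$ (p, \<pi> p)))"
    proof (intro sum.cong refl arg_cong2[of _ _ _ _ "(*)"])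
      fix \<phi>
      have "(\<Prod>p = 0..<n. N \<phi> $$ (p, \<pi> p))
          = (\<Prod>p<k * r. N \<phi> $$ (p, \<pi> p)) * (\<Prod>j<length fs. N \<phi> $$ (k * r + j, \<pi> (k * r + j)))"
        by (simp add: n[symmetric] prod_lessThan_add flip: lessThan_atLeast0)
      also have "(\<Prod>p<k * r. N \<phi> $$ (p, \<pi> p)) = T"
        unfolding T_def using \<pi> n by (intro prod.cong refl top[symmetric]) auto
      also have "(\<Prod>j<length fs. N \<phi> $$ (k * r + j, \<pi> (k * r + j))) = (\<Prod>f\<in>set fs. b (\<phi> f) f (c f))"
        using \<pi> n idx
        by (subst prod_set_nth[OF dist]) (auto simp: N_bottom c_def simp flip: idx_def intro!: prod.cong)
      finally show "T * (\<Prod>f\<in>set fs. b (\<phi> f) f (c f)) = (\<Prod>p = 0..<n. N \<phi> $$ (p, \<pi> p))" ..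
    qed
    finally show ?thesis .
  qed
  have "det M = (\<Sum>\<pi> | \<pi> permutes {0..<n}. \<Sum>\<phi> \<in> set fs \<rightarrow>\<^sub>E {..<k}.
      (\<Prod>f\<in>set fs. x (edge_label f) ^ \<phi> f) * (signof \<pi> * (\<Prod>p = 0..<n. N \<phi> $$ (p, \<pi> p))))"
    by (simp add: det_def'[OF M] perm_term sum_distrib_left mult_ac)
  also have "\<dots> = (\<Sum>\<phi> \<in> set fs \<rightarrow>\<^sub>E {..<k}. (\<Prod>f\<in>set fs. x (edge_label f) ^ \<phi> f) * det (N \<phi>))"
    by (subst sum.swap) (simp add: det_def'[OF N] sum_distrib_left)
  finally show ?thesis
    by (simp add: M_def N_def)
qed

section \<open>Colourings with connected classes are tree decompositions\<close>

definition colour_classes :: "nat \<Rightarrow> lab_edge set \<Rightarrow> (lab_edge \<Rightarrow> nat) \<Rightarrow> lab_edge set list" where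
  "colour_classes k E \<phi> = map (\<lambda>i. {f \<in> E. \<phi> f = i}) [0..<k]"

lemma sum_eq_lower_bound:
  assumes "\<And>i. i < k \<Longrightarrow> c \<le> (a i :: nat)" "(\<Sum>i<k. a i) = k * c" "i < k"
  shows "a i = c"
proof (rule ccontr)
  assume "a i \<noteq> c"
  with assms(1,3) have "c < a i"
    by (metis le_neq_implies_less)
  then have "(\<Sum>i<k. c) < (\<Sum>i<k. a i)"
    using assms by (intro sum_strict_mono_ex1) auto
  with assms(2) show False
    by simp
qed

text \<open>The lower bound \<open>t - 1\<close> for each connected part is attained on average, hence everywhere. It also
  holds for the simple graph of the endpoint pairs, so no two edges of a part are parallel.\<close>

lemma connected_classes_card:
  assumes fin: "finite E" and card: "card E = k * (t - 1)"
    and Q: "(\<Union>i<k. Q i) = E" "\<And>i j. i < k \<Longrightarrow> j < k \<Longrightarrow> i \<noteq> j \<Longrightarrow> Q i \<inter> Q j = {}"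
    and conn: "\<And>i. i < k \<Longrightarrow> graph_connected ends {1..t} (Q i)" and i: "i < k"
  shows "card (Q i) = t - 1" "card (ends ` Q i) = t - 1"
proof -
  have finQ: "finite (Q i)" if "i < k" for i
    using that fin Q(1) by (metis UN_upper finite_subset lessThan_iff)
  have "card E = (\<Sum>i<k. card (Q i))"
    unfolding Q(1)[symmetric] using finQ Q(2) by (intro card_UN_disjoint) auto
  then have total: "(\<Sum>i<k. card (Q i)) = k * (t - 1)"
    using card by simp
  have ge: "t - 1 \<le> card (Q i)" if "i < k" for i
    using connected_card_edges_ge[OF conn finQ] that by simp
  show c: "card (Q i) = t - 1"
    by (rule sum_eq_lower_bound[where a = "\<lambda>i. card (Q i)", OF ge total i])
  have "t - 1 \<le> card (ends ` Q i)"
    using connected_card_edges_ge[OF connected_image[OF conn[OF i]]] finQ[OF i] by simp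
  then show "card (ends ` Q i) = t - 1"
    using c card_image_le[OF finQ[OF i], of ends] by simp
qed

text \<open>The edge count turns connectedness of all classes into acyclicity, so a colouring need only be
  tested for connected classes.\<close>

lemma bij_betw_colour_classes:
  assumes fin: "finite E" and card: "card E = k * (t - 1)"
    and ends: "\<And>f. f \<in> E \<Longrightarrow> edge_ends f \<subseteq> {1..t} \<and> card (edge_ends f) = 2"
  shows "bij_betw (colour_classes k E)
     {\<phi> \<in> E \<rightarrow>\<^sub>E {..<k}. \<forall>i<k. graph_connected edge_ends {1..t} {f \<in> E. \<phi> f = i}}
     (tree_decomps t k E)"
    (is "bij_betw _ ?C ?D")
proof (rule bij_betw_imageI)
  show "inj_on (colour_classes k E) ?C"
  proof (rule inj_onI)
    fix \<phi> \<psi> assume *: "\<phi> \<in> ?C" "\<psi> \<in> ?C" "colour_classes k E \<phi> = colour_classes k E \<psi>"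
    then have \<phi>: "\<phi> \<in> E \<rightarrow>\<^sub>E {..<k}" and \<psi>: "\<psi> \<in> E \<rightarrow>\<^sub>E {..<k}"
      by blast+
    have same: "{f \<in> E. \<phi> f = i} = {f \<in> E. \<psi> f = i}" if "i < k" for i
      using arg_cong[OF *(3), of "\<lambda>Q. Q ! i"] that by (simp add: colour_classes_def)
    show "\<phi> = \<psi>"
    proof (rule PiE_ext[OF \<phi> \<psi>])
      fix f assume "f \<in> E"
      moreover from this \<phi> have "\<phi> f < k"
        by auto
      ultimately have "f \<in> {g \<in> E. \<psi> g = \<phi> f}"
        using same[of "\<phi> f"] by blast
      then show "\<phi> f = \<psi> f"
        by simp
    qed
  qed
  show "colour_classes k E ` ?C = ?D"
  proof (intro equalityI subsetI)
    fix Q assume "Q \<in> colour_classes k E ` ?C"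
    then obtain \<phi> where \<phi>: "\<phi> \<in> E \<rightarrow>\<^sub>E {..<k}" and Q: "Q = colour_classes k E \<phi>"
      and conn: "\<And>i. i < k \<Longrightarrow> graph_connected edge_ends {1..t} {f \<in> E. \<phi> f = i}"
      by blast
    have union: "(\<Union>i<k. {f \<in> E. \<phi> f = i}) = E"
      using \<phi> by auto
    have "is_tree edge_ends {1..t} {f \<in> E. \<phi> f = i}" if i: "i < k" for i
    proof (rule connected_card_imp_tree[OF _ conn[OF i]])
      show "card {f \<in> E. \<phi> f = i} \<le> card {1..t} - 1"
        by (subst connected_classes_card(1)[OF fin card union _ conn i]) auto
    qed (use fin ends in auto)
    then show "Q \<in> ?D"
      using union by (auto simp: tree_decomps_def Q colour_classes_def)
  next
    fix Q assume "Q \<in> ?D"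
    then have Q: "length Q = k" "\<And>i j. i < k \<Longrightarrow> j < k \<Longrightarrow> i \<noteq> j \<Longrightarrow> Q ! i \<inter> Q ! j = {}"
      "(\<Union>i<k. Q ! i) = E" "\<And>i. i < k \<Longrightarrow> is_tree edge_ends {1..t} (Q ! i)"
      by (auto simp: tree_decomps_def)
    define \<phi> where "\<phi> = restrict (\<lambda>f. THE i. i < k \<and> f \<in> Q ! i) E"
    have \<phi>: "\<phi> f = i" if "i < k" "f \<in> Q ! i" for f i
    proof -
      have "f \<in> E"
        using Q(3) that by blast
      moreover have "(THE i. i < k \<and> f \<in> Q ! i) = i"
        using that Q(2) by (intro the_equality) blast+
      ultimately show ?thesis
        by (simp add: \<phi>_def)
    qed
    have mem: "\<exists>i<k. f \<in> Q ! i" if "f \<in> E" for f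
      using Q(3) that by blast
    have cls: "{f \<in> E. \<phi> f = i} = Q ! i" if "i < k" for i
    proof (intro equalityI subsetI)
      fix f assume "f \<in> {f \<in> E. \<phi> f = i}"
      then show "f \<in> Q ! i"
        using mem[of f] \<phi>[of _ f] by blast
    next
      fix f assume "f \<in> Q ! i"
      then show "f \<in> {f \<in> E. \<phi> f = i}"
        using \<phi>[OF that] Q(3) that by blast
    qed
    have "\<phi> \<in> E \<rightarrow>\<^sub>E {..<k}"
    proof (rule PiE_I)
      fix f assume "f \<in> E"
      then show "\<phi> f \<in> {..<k}"
        using mem[of f] \<phi>[of _ f] by fastforce
    qed (simp add: \<phi>_def)
    then have "\<phi> \<in> ?C"
      using Q(4) cls by (auto simp: is_tree_def)
    moreover have "colour_classes k E \<phi> = Q"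
      using Q(1) cls by (intro nth_equalityI) (auto simp: colour_classes_def)
    ultimately show "Q \<in> colour_classes k E ` ?C"
      by blast
  qed
qed

lemma sigma_colour_classes:
  assumes fin: "finite E" and \<phi>: "\<phi> \<in> E \<rightarrow>\<^sub>E {..<k}"
  shows "sigma k E (colour_classes k E \<phi>) s = (\<Sum>f \<in> {f \<in> E. edge_label f = s}. \<phi> f)"
proof -
  have "(\<Sum>f \<in> {f \<in> E. edge_label f = s}. \<phi> f)
      = (\<Sum>i<k. \<Sum>f \<in> {f \<in> {f \<in> E. edge_label f = s}. \<phi> f = i}. \<phi> f)"
    using fin \<phi> by (intro sum.group[symmetric]) auto
  also have "\<dots> = (\<Sum>i<k. i * card ({f \<in> E. \<phi> f = i} \<inter> {f \<in> E. edge_label f = s}))"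
  proof (intro sum.cong refl)
    fix i
    have "(\<Sum>f \<in> {f \<in> {f \<in> E. edge_label f = s}. \<phi> f = i}. \<phi> f)
        = (\<Sum>f \<in> {f \<in> {f \<in> E. edge_label f = s}. \<phi> f = i}. i)"
      by (rule sum.cong) auto
    moreover have "{f \<in> {f \<in> E. edge_label f = s}. \<phi> f = i} = {f \<in> E. \<phi> f = i} \<inter> {f \<in> E. edge_label f = s}"
      by blast
    ultimately show "(\<Sum>f \<in> {f \<in> {f \<in> E. edge_label f = s}. \<phi> f = i}. \<phi> f)
        = i * card ({f \<in> E. \<phi> f = i} \<inter> {f \<in> E. edge_label f = s})"
      by (simp only: sum_constant of_nat_id mult.commute)
  qed
  finally show ?thesis
    by (simp add: sigma_def colour_classes_def)
qed

lemma label_monomial: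
  fixes x :: "nat \<Rightarrow> 'b :: comm_monoid_mult"
  assumes fin: "finite E" and \<phi>: "\<phi> \<in> E \<rightarrow>\<^sub>E {..<k}" and lab: "edge_label ` E \<subseteq> {1..n}"
  shows "(\<Prod>f\<in>E. x (edge_label f) ^ \<phi> f) = (\<Prod>s = 1..n. x s ^ sigma k E (colour_classes k E \<phi>) s)"
proof -
  have "(\<Prod>f\<in>E. x (edge_label f) ^ \<phi> f)
      = (\<Prod>s = 1..n. \<Prod>f \<in> {f \<in> E. edge_label f = s}. x (edge_label f) ^ \<phi> f)"
    using fin lab by (intro prod.group[symmetric]) auto
  then show ?thesis
    by (simp add: sigma_colour_classes[OF fin \<phi>] power_sum)
qed

section \<open>Coefficients of the monomials\<close>

lemma monomial_eq_single:
  "(\<Prod>s = 1..n. Var s ^ e s :: 'a :: comm_ring_1 mpoly)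
    = Poly_Mapping.single (\<Sum>s = 1..n. Poly_Mapping.single s (e s)) 1"
proof -
  have "Var s ^ e = (Poly_Mapping.single (Poly_Mapping.single s e) 1 :: 'a mpoly)" for s e
    by (induction e) (simp_all add: Var_def mult_single single_add[symmetric])
  moreover have "(\<Prod>s\<in>S. Poly_Mapping.single (g s) 1 :: 'a mpoly) = Poly_Mapping.single (\<Sum>s\<in>S. g s) 1"
    for S :: "nat set" and g
    by (induction S rule: infinite_finite_induct) (simp_all add: mult_single)
  ultimately show ?thesis
    by simp
qed

lemma lookup_const_monomial:
  assumes "Poly_Mapping.keys \<alpha> \<subseteq> {1..n}"
  shows "Poly_Mapping.lookup (Const c * (\<Prod>s = 1..n. Var s ^ e s :: 'a :: comm_ring_1 mpoly)) \<alpha>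
    = (if \<forall>s\<in>{1..n}. e s = Poly_Mapping.lookup \<alpha> s then c else 0)"
proof -
  define \<mu> where "\<mu> = (\<Sum>s = 1..n. Poly_Mapping.single s (e s))"
  have \<mu>: "Poly_Mapping.lookup \<mu> s = (if s \<in> {1..n} then e s else 0)" for s
    by (simp add: \<mu>_def lookup_sum lookup_single when_def)
  have "\<mu> = \<alpha> \<longleftrightarrow> (\<forall>s\<in>{1..n}. e s = Poly_Mapping.lookup \<alpha> s)"
  proof
    assume *: "\<forall>s\<in>{1..n}. e s = Poly_Mapping.lookup \<alpha> s"
    show "\<mu> = \<alpha>"
    proof (rule poly_mapping_eqI)
      fix s show "Poly_Mapping.lookup \<mu> s = Poly_Mapping.lookup \<alpha> s"
        using * assms unfolding \<mu> by (cases "s \<in> {1..n}") (auto simp: in_keys_iff)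
    qed
  qed (use \<mu> in auto)
  then show ?thesis
    unfolding monomial_eq_single Const_def mult_single \<mu>_def[symmetric]
    by (simp add: lookup_single when_def del: One_nat_def)
qed

section \<open>The determinant as a sum over decompositions\<close>

lemma assignment_edge_props:
  assumes "tree_assignment t n I T" and "f \<in> assignment_edges t n I T"
  shows "edge_ends f \<subseteq> {1..t}" "card (edge_ends f) = 2" "edge_label f \<in> {1..n}"
proof -
  obtain s a where f: "f = ((s, support t I s), a)" "(s, support t I s) \<in> hyperedges t n I"
    "a \<in> T (s, support t I s)" "s \<in> {1..n}"
    using assms(2) unfolding assignment_edges_def hyperedges_def by blast
  then have tree: "is_tree id (support t I s) (T (s, support t I s))"
    using assms(1) unfolding tree_assignment_def by blast
  then have "a \<subseteq> support t I s" "card a = 2"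
    using f(3) unfolding is_tree_def by auto
  then show "edge_ends f \<subseteq> {1..t}" "card (edge_ends f) = 2" "edge_label f \<in> {1..n}"
    using f by (auto simp: edge_ends_def edge_label_def support_def)
qed

text \<open>Only colourings with connected classes contribute, and each contributes an integer unit. The sign
  \<open>\<epsilon> Q\<close> is the product of this unit with the product \<open>dB Q\<close> of the complementary minors; since
  \<open>dB Q\<close> squares to one, multiplying by it once more, as \<open>coeff_scalar\<close> does, gives the unit back.\<close>

lemma det_M_mat_decompositions:
  assumes t: "t \<ge> 2" and T: "tree_assignment t n I T"
    and card: "card (assignment_edges t n I T) = k * (t - 1)"
    and fs: "distinct fs" "set fs = assignment_edges t n I T"
  defines "E \<equiv> assignment_edges t n I T"
  defines "D \<equiv> tree_decomps t k E"
  shows "\<exists>\<epsilon> :: lab_edge set list \<Rightarrow> int.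
     (\<forall>Q\<in>D. \<epsilon> Q \<in> {1, -1}) \<and>
     (\<forall>Q\<in>D. (coeff_scalar t k \<epsilon> Q :: 'a :: field) \<noteq> 0) \<and>
     det (M_mat t k fs (Var :: nat \<Rightarrow> 'a mpoly)) =
       (\<Sum>Q\<in>D. Const (coeff_scalar t k \<epsilon> Q) * (\<Prod>s=1..n. Var s ^ sigma k E Q s))"
proof -
  have set_fs: "set fs = E"
    by (simp add: E_def fs)
  have fin: "finite E" and card: "card E = k * (t - 1)"
    using set_fs card by (auto simp: E_def[symmetric])
  have len: "length fs = k * (t - 1)"
    using distinct_card[OF fs(1)] set_fs card by simp
  have ends: "edge_ends f \<subseteq> {1..t} \<and> card (edge_ends f) = 2" if "f \<in> E" for f
    using assignment_edge_props[OF T] that by (auto simp: E_def)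
  have label: "edge_label ` E \<subseteq> {1..n}"
    using assignment_edge_props(3)[OF T] by (auto simp: E_def)
  define C where "C = {\<phi> \<in> E \<rightarrow>\<^sub>E {..<k}. \<forall>i<k. graph_connected edge_ends {1..t} {f \<in> E. \<phi> f = i}}"
  have bij: "bij_betw (colour_classes k E) C D"
    unfolding C_def D_def by (rule bij_betw_colour_classes[OF fin card ends])
  define colouring where "colouring = the_inv_into C (colour_classes k E)"
  have colouring: "colouring (colour_classes k E \<phi>) = \<phi>" if "\<phi> \<in> C" for \<phi>
    using bij that by (auto simp: colouring_def bij_betw_def the_inv_into_f_f)
  define dN where "dN \<phi> = det (colour_mat t k fs \<phi>)" for \<phi>
  define dB :: "lab_edge set list \<Rightarrow> int" where
    "dB Q = (\<Prod>i<k. det (B_cols t (set (K_edges t) - edge_ends ` (Q ! i))))" for Q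
  define \<epsilon> where "\<epsilon> Q = dN (colouring Q) * dB Q" for Q
  have dN: "dN \<phi> \<in> {1, - 1}" if "\<phi> \<in> C" for \<phi>
    unfolding dN_def
    by (rule det_colour_mat_unit[OF t len]) (use ends that in \<open>auto simp: set_fs C_def\<close>)
  have dB: "dB Q \<in> {1, - 1}" if "Q \<in> D" for Q
  proof -
    have Q: "\<And>i j. i < k \<Longrightarrow> j < k \<Longrightarrow> i \<noteq> j \<Longrightarrow> Q ! i \<inter> Q ! j = {}" "(\<Union>i<k. Q ! i) = E"
      "\<And>i. i < k \<Longrightarrow> graph_connected edge_ends {1..t} (Q ! i)"
      using that by (auto simp: D_def tree_decomps_def is_tree_def)
    have unit: "det (B_cols t (set (K_edges t) - edge_ends ` (Q ! i)) :: int mat) \<in> {1, - 1}" if "i < k" for i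
    proof (rule det_B_cols_unit[OF t Q(3)[OF that]])
      show "card (edge_ends ` (Q ! i)) = t - 1"
        by (rule connected_classes_card(2)[OF fin card Q(2) Q(1) Q(3) that])
      show "edge_ends f \<subseteq> {1..t} \<and> card (edge_ends f) = 2" if "f \<in> Q ! i" for f
        using that \<open>i < k\<close> Q(2) ends by blast
    qed
    have units: "(\<Prod>i\<in>J. g i) \<in> {1, - 1}" if "\<And>i. i \<in> J \<Longrightarrow> g i \<in> {1, - 1}" for J :: "nat set" and g :: "nat \<Rightarrow> int"
      using that by (induction J rule: infinite_finite_induct) (simp, simp, fastforce)
    show ?thesis
      unfolding dB_def by (rule units) (use unit in auto)
  qed
  have colouring_in: "colouring Q \<in> C" if "Q \<in> D" for Q
    using bij_betw_the_inv_into[OF bij] that by (auto simp: colouring_def bij_betw_def)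
  have \<epsilon>: "\<epsilon> Q \<in> {1, - 1}" if "Q \<in> D" for Q
    using dN[OF colouring_in[OF that]] dB[OF that] by (auto simp: \<epsilon>_def)
  have coeff: "coeff_scalar t k \<epsilon> Q = (of_int (dN (colouring Q)) :: 'a)" if "Q \<in> D" for Q
  proof -
    have "(\<Prod>i<k. det (B_cols t (set (K_edges t) - edge_ends ` (Q ! i)))) = (of_int (dB Q) :: 'a)"
      unfolding dB_def by (subst B_cols_hom) simp
    then have "coeff_scalar t k \<epsilon> Q = (of_int (\<epsilon> Q * dB Q) :: 'a)"
      by (simp add: coeff_scalar_def)
    also have "\<epsilon> Q * dB Q = dN (colouring Q)"
      using dB[OF that] by (auto simp: \<epsilon>_def)
    finally show ?thesis .
  qed
  have nonzero: "(coeff_scalar t k \<epsilon> Q :: 'a) \<noteq> 0" if "Q \<in> D" for Q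
    using coeff[OF that] dN[OF colouring_in[OF that]] by auto
  have "det (M_mat t k fs (Var :: nat \<Rightarrow> 'a mpoly)) = (\<Sum>\<phi> \<in> E \<rightarrow>\<^sub>E {..<k}.
      (\<Prod>f\<in>E. Var (edge_label f) ^ \<phi> f) * of_int (dN \<phi>))"
    unfolding dN_def set_fs[symmetric] by (rule det_M_mat_expansion[OF t fs(1) len])
  also have "\<dots> = (\<Sum>\<phi>\<in>C. (\<Prod>f\<in>E. Var (edge_label f) ^ \<phi> f) * of_int (dN \<phi>))"
  proof (rule sum.mono_neutral_right)
    show "\<forall>\<phi> \<in> (E \<rightarrow>\<^sub>E {..<k}) - C. (\<Prod>f\<in>E. Var (edge_label f) ^ \<phi> f) * of_int (dN \<phi>) = (0 :: 'a mpoly)"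
    proof
      fix \<phi> assume \<phi>: "\<phi> \<in> (E \<rightarrow>\<^sub>E {..<k}) - C"
      then obtain i where "i < k" "\<not> graph_connected edge_ends {1..t} {f \<in> set fs. \<phi> f = i}"
        unfolding C_def set_fs by blast
      then have "dN \<phi> = 0"
        unfolding dN_def by (intro det_colour_mat_zero[OF t len]) (use \<phi> ends in \<open>auto simp: set_fs\<close>)
      then show "(\<Prod>f\<in>E. Var (edge_label f) ^ \<phi> f) * of_int (dN \<phi>) = (0 :: 'a mpoly)"
        by simp
    qed
  qed (auto simp: C_def fin intro!: finite_PiE)
  also have "\<dots> = (\<Sum>\<phi>\<in>C. Const (coeff_scalar t k \<epsilon> (colour_classes k E \<phi>))
      * (\<Prod>s=1..n. Var s ^ sigma k E (colour_classes k E \<phi>) s))"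
  proof (intro sum.cong refl)
    fix \<phi> assume \<phi>: "\<phi> \<in> C"
    then have "colour_classes k E \<phi> \<in> D"
      using bij by (auto simp: bij_betw_def)
    then have "Const (coeff_scalar t k \<epsilon> (colour_classes k E \<phi>)) = (of_int (dN \<phi>) :: 'a mpoly)"
      by (simp add: coeff colouring[OF \<phi>] Const_def)
    moreover have "\<phi> \<in> E \<rightarrow>\<^sub>E {..<k}"
      using \<phi> by (simp add: C_def)
    ultimately show "(\<Prod>f\<in>E. Var (edge_label f) ^ \<phi> f) * of_int (dN \<phi>)
        = Const (coeff_scalar t k \<epsilon> (colour_classes k E \<phi>))
          * (\<Prod>s=1..n. Var s ^ sigma k E (colour_classes k E \<phi>) s :: 'a mpoly)"
      by (simp add: label_monomial[OF fin _ label] mult.commute)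
  qed
  also have "\<dots> = (\<Sum>Q\<in>D. Const (coeff_scalar t k \<epsilon> Q) * (\<Prod>s=1..n. Var s ^ sigma k E Q s))"
    by (rule sum.reindex_bij_betw[OF bij])
  finally show ?thesis
    using \<epsilon> nonzero by blast
qed

lemma lookup_decomposition_sum:
  assumes "finite D" "Poly_Mapping.keys \<alpha> \<subseteq> {1..n}"
  shows "Poly_Mapping.lookup (\<Sum>Q\<in>D. Const (c Q) * (\<Prod>s=1..n. Var s ^ e Q s :: 'a :: comm_ring_1 mpoly)) \<alpha>
    = (\<Sum>Q \<in> {Q \<in> D. \<forall>s\<in>{1..n}. e Q s = Poly_Mapping.lookup \<alpha> s}. c Q)"
  using assms(1) by (simp add: lookup_sum lookup_const_monomial[OF assms(2)] sum.inter_filter del: One_nat_def)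

lemma finite_tree_decomps:
  assumes "finite E" shows "finite (tree_decomps t k E)"
proof (rule finite_subset)
  show "tree_decomps t k E \<subseteq> {Q. set Q \<subseteq> Pow E \<and> length Q = k}"
    by (auto simp: tree_decomps_def in_set_conv_nth)
  show "finite {Q. set Q \<subseteq> Pow E \<and> length Q = k}"
    using assms by (intro finite_lists_length_eq) simp
qed

section \<open>A cancelling pair of decompositions\<close>

lemma star_is_tree:
  assumes "ends f = {1, 2}" "ends g = {1, 3 :: nat}" "f \<noteq> g"
  shows "is_tree ends {1..3} {f, g}"
proof (rule connected_card_imp_tree)
  have V: "{1..3} = {1, 2, 3 :: nat}"
    by auto
  have "(1, 2) \<in> adjacency ends {f, g}" "(1, 3) \<in> adjacency ends {f, g}"
    unfolding adjacency_def using assms by blast+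
  then have to: "(1, v) \<in> (adjacency ends {f, g})\<^sup>*" if "v \<in> {1..3}" for v
    using that unfolding V by auto
  then have "(u, v) \<in> (adjacency ends {f, g})\<^sup>*" if "u \<in> {1..3}" "v \<in> {1..3}" for u v
    using that symD[OF sym_rtrancl[OF sym_adjacency]] by (meson rtrancl_trans)
  then show "graph_connected ends {1..3} {f, g}"
    by (simp add: graph_connected_adjacency)
qed (use assms in auto)

lemma parallel_not_tree:
  assumes "ends f = {x, y}" "ends g = {x, y}" "f \<noteq> g" "x \<noteq> y" "f \<in> Q" "g \<in> Q"
  shows "\<not> is_tree ends V Q"
proof -
  have "graph_cycle ends Q [x, y] [f, g]"
    using assms by (auto simp: graph_cycle_def less_Suc_eq insert_commute numeral_2_eq_2)
  then show ?thesis
    by (auto simp: is_tree_def)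
qed

lemma card_inter_pair:
  assumes "card (Q \<inter> {a, b}) = 1"
  shows "Q \<inter> {a, b} = {a} \<or> Q \<inter> {a, b} = {b}"
proof -
  obtain x where x: "Q \<inter> {a, b} = {x}"
    using assms by (rule card_1_singletonE)
  then have "x \<in> {a, b}"
    by blast
  with x show ?thesis
    by blast
qed

text \<open>The exponents \<open>(1, 1)\<close> force the second tree to contain one edge of each label. Two edges with the
  same ends would be parallel, so only the two mixed choices remain; the first tree is the
  complement.\<close>

lemma cancelling_decompositions:
  fixes f1 g1 f2 g2 :: lab_edge
  assumes f1: "f1 = ((1, V), {1, 2})" and g1: "g1 = ((1, V), {1, 3})"
    and f2: "f2 = ((2, V), {1, 2})" and g2: "g2 = ((2, V), {1, 3})"
    and E: "E = {f1, g1, f2, g2}"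
  shows "{Q \<in> tree_decomps 3 2 E. \<forall>s\<in>{1..2}. sigma 2 E Q s = 1}
    = {[{f1, g2}, {f2, g1}], [{f2, g1}, {f1, g2}]}" (is "?S = ?R")
proof -
  have ne: "f1 \<noteq> g1" "f1 \<noteq> f2" "f1 \<noteq> g2" "g1 \<noteq> f2" "g1 \<noteq> g2" "f2 \<noteq> g2"
    by (auto simp: f1 g1 f2 g2 doubleton_eq_iff)
  have ends: "edge_ends f1 = {1, 2}" "edge_ends f2 = {1, 2}" "edge_ends g1 = {1, 3}" "edge_ends g2 = {1, 3}"
    by (auto simp: f1 g1 f2 g2 edge_ends_def)
  have L: "{f \<in> E. edge_label f = 1} = {f1, g1}" "{f \<in> E. edge_label f = 2} = {f2, g2}"
    by (auto simp: E f1 g1 f2 g2 edge_label_def)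
  have sigma: "sigma 2 E Q 1 = card (Q ! 1 \<inter> {f1, g1})" "sigma 2 E Q 2 = card (Q ! 1 \<inter> {f2, g2})" for Q
    unfolding sigma_def L by (simp_all add: numeral_2_eq_2 lessThan_Suc)
  have two: "{1..2} = {1, 2 :: nat}"
    by auto
  have less2: "i < 2 \<longleftrightarrow> i = 0 \<or> i = (1 :: nat)" for i
    by auto
  have trees: "is_tree edge_ends {1..3} {f1, g2}" "is_tree edge_ends {1..3} {f2, g1}"
    by (rule star_is_tree; use ends ne in simp)+
  have decomp: "[A, B] \<in> ?S"
    if "A \<inter> B = {}" "A \<union> B = E" "is_tree edge_ends {1..3} A" "is_tree edge_ends {1..3} B"
      "card (B \<inter> {f1, g1}) = 1" "card (B \<inter> {f2, g2}) = 1" for A B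
  proof -
    have "sigma 2 E [A, B] 1 = 1" "sigma 2 E [A, B] 2 = 1"
      using sigma(1)[of "[A, B]"] sigma(2)[of "[A, B]"] that(5,6) by (simp_all only: nth_Cons_Suc nth_Cons_0 One_nat_def)
    then have "\<forall>s\<in>{1..2}. sigma 2 E [A, B] s = 1"
      unfolding two by blast
    moreover have "[A, B] \<in> tree_decomps 3 2 E"
      using that(1-4) by (auto simp: tree_decomps_def less2)
    ultimately show ?thesis
      by blast
  qed
  show ?thesis
  proof (intro equalityI subsetI)
    have parts: "{f1, g2} \<inter> {f1, g1} = {f1}" "{f1, g2} \<inter> {f2, g2} = {g2}"
      "{f2, g1} \<inter> {f1, g1} = {g1}" "{f2, g1} \<inter> {f2, g2} = {f2}"
      "{f1, g2} \<inter> {f2, g1} = {}" "{f2, g1} \<inter> {f1, g2} = {}"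
      "{f1, g2} \<union> {f2, g1} = E" "{f2, g1} \<union> {f1, g2} = E"
      using ne unfolding E by auto
    have singleton: "card {f} = 1" for f :: lab_edge
      by simp
    have "[{f1, g2}, {f2, g1}] \<in> ?S" "[{f2, g1}, {f1, g2}] \<in> ?S"
      by (rule decomp; simp only: parts singleton trees)+
    moreover fix Q assume "Q \<in> ?R"
    ultimately show "Q \<in> ?S"
      by blast
  next
    fix Q assume Q: "Q \<in> ?S"
    then have len: "length Q = 2" and disj: "Q ! 0 \<inter> Q ! 1 = {}" and union: "(\<Union>i<2. Q ! i) = E"
      and tree: "is_tree edge_ends {1..3} (Q ! 0)" "is_tree edge_ends {1..3} (Q ! 1)"
      by (auto simp: tree_decomps_def)
    have Q0: "Q ! 0 = E - Q ! 1" and sub: "Q ! 1 \<subseteq> E"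
      using disj union by (auto simp: less2)
    have "sigma 2 E Q 1 = 1" "sigma 2 E Q 2 = 1"
      using Q unfolding two by blast+
    then have "Q ! 1 \<inter> {f1, g1} = {f1} \<or> Q ! 1 \<inter> {f1, g1} = {g1}"
      "Q ! 1 \<inter> {f2, g2} = {f2} \<or> Q ! 1 \<inter> {f2, g2} = {g2}"
      unfolding sigma by - (rule card_inter_pair, assumption)+
    moreover have "\<not> (f1 \<in> Q ! 1 \<and> f2 \<in> Q ! 1)" "\<not> (g1 \<in> Q ! 1 \<and> g2 \<in> Q ! 1)"
      using parallel_not_tree[of edge_ends f1 1 2 f2 "Q ! 1"] parallel_not_tree[of edge_ends g1 1 3 g2 "Q ! 1"] ends ne tree
      by auto
    ultimately have "Q ! 1 = {f2, g1} \<or> Q ! 1 = {f1, g2}"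
      using sub unfolding E by blast
    moreover have "Q = [Q ! 0, Q ! 1]"
      using len by (intro nth_equalityI) (auto simp: less2)
    moreover have "E - {f2, g1} = {f1, g2}" "E - {f1, g2} = {f2, g1}"
      using ne unfolding E by auto
    ultimately show "Q \<in> ?R"
      using Q0 by (metis insertCI)
  qed
qed

section \<open>The determinant formula and its possible cancellation\<close>

theorem lemma3p4:
  shows
    "(\<forall>t k n (I :: nat \<Rightarrow> nat set) T fs.
        t \<ge> 2 \<and> k \<ge> 1 \<and> n \<ge> 1 \<and> (\<forall>j\<in>{1..t}. I j \<subseteq> {1..n}) \<and> tree_assignment t n I T \<and>
        card (assignment_edges t n I T) = k * (t - 1) \<and>
        distinct fs \<and> set fs = assignment_edges t n I T
        \<longrightarrow>
        (let E = assignment_edges t n I T; D = tree_decomps t k E in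
         \<exists>\<epsilon> :: lab_edge set list \<Rightarrow> int.
           (\<forall>Q\<in>D. \<epsilon> Q \<in> {1, -1}) \<and>
           (\<forall>Q\<in>D. (coeff_scalar t k \<epsilon> Q :: 'a :: field) \<noteq> 0) \<and>
           det (M_mat t k fs (Var :: nat \<Rightarrow> 'a mpoly)) =
             (\<Sum>Q\<in>D. Const (coeff_scalar t k \<epsilon> Q) * (\<Prod>s=1..n. Var s ^ sigma k E Q s)) \<and>
           (\<forall>\<alpha> :: nat \<Rightarrow>\<^sub>0 nat. Poly_Mapping.keys \<alpha> \<subseteq> {1..n} \<longrightarrow>
             Poly_Mapping.lookup (det (M_mat t k fs (Var :: nat \<Rightarrow> 'a mpoly))) \<alpha> =
               (\<Sum>Q \<in> {Q\<in>D. \<forall>s\<in>{1..n}. sigma k E Q s = Poly_Mapping.lookup \<alpha> s}.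
                  coeff_scalar t k \<epsilon> Q))))
     \<and>
     (\<exists>t k n (I :: nat \<Rightarrow> nat set) T fs.
        t \<ge> 2 \<and> k \<ge> 1 \<and> n \<ge> 1 \<and> (\<forall>j\<in>{1..t}. I j \<subseteq> {1..n}) \<and> tree_assignment t n I T \<and>
        card (assignment_edges t n I T) = k * (t - 1) \<and>
        distinct fs \<and> set fs = assignment_edges t n I T \<and>
        (let E = assignment_edges t n I T; D = tree_decomps t k E in
         \<exists>(\<epsilon> :: lab_edge set list \<Rightarrow> int) (\<alpha> :: nat \<Rightarrow>\<^sub>0 nat).
           (\<forall>Q\<in>D. \<epsilon> Q \<in> {1, -1}) \<and>
           det (M_mat t k fs (Var :: nat \<Rightarrow> bit mpoly)) =
             (\<Sum>Q\<in>D. Const (coeff_scalar t k \<epsilon> Q) * (\<Prod>s=1..n. Var s ^ sigma k E Q s)) \<and>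
           Poly_Mapping.keys \<alpha> \<subseteq> {1..n} \<and>
           {Q\<in>D. \<forall>s\<in>{1..n}. sigma k E Q s = Poly_Mapping.lookup \<alpha> s} \<noteq> {} \<and>
           (\<Sum>Q \<in> {Q\<in>D. \<forall>s\<in>{1..n}. sigma k E Q s = Poly_Mapping.lookup \<alpha> s}.
              (coeff_scalar t k \<epsilon> Q :: bit)) = 0))"
proof (intro conjI allI impI, goal_cases)
  case (1 t k n I T fs)
  define E where "E = assignment_edges t n I T"
  define D where "D = tree_decomps t k E"
  have "finite D"
    using 1 finite_tree_decomps[of E t k] by (metis D_def E_def List.finite_set)
  moreover obtain \<epsilon> :: "lab_edge set list \<Rightarrow> int" where "\<forall>Q\<in>D. \<epsilon> Q \<in> {1, -1}"
    "\<forall>Q\<in>D. (coeff_scalar t k \<epsilon> Q :: 'a) \<noteq> 0"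
    "det (M_mat t k fs (Var :: nat \<Rightarrow> 'a mpoly)) =
       (\<Sum>Q\<in>D. Const (coeff_scalar t k \<epsilon> Q) * (\<Prod>s=1..n. Var s ^ sigma k E Q s))"
    using det_M_mat_decompositions[of t n I T k fs, where 'a = 'a] 1 unfolding E_def D_def by blast
  ultimately show ?case
    unfolding Let_def E_def[symmetric] D_def[symmetric]
    by (intro exI[of _ \<epsilon>] conjI allI impI) (simp_all only: lookup_decomposition_sum)
next
  case 2
  define I :: "nat \<Rightarrow> nat set" where "I = (\<lambda>_. {1..2})"
  define T :: "occurrence \<Rightarrow> nat set set" where "T = (\<lambda>_. {{1, 2}, {1, 3}})"
  define V :: "nat set" where "V = {1..3}"
  define E where "E = assignment_edges 3 2 I T"
  define D where "D = tree_decomps 3 2 E"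
  have support: "support 3 I s = V" if "s \<in> {1..2}" for s
    using that by (auto simp: support_def I_def V_def)
  have hyper: "hyperedges 3 2 I = {(1, V), (2, V)}"
  proof -
    have "hyperedges 3 2 I = (\<lambda>s. (s, V)) ` {1..2}"
      using support by (auto simp: hyperedges_def V_def)
    moreover have "{1..2} = {1, 2 :: nat}"
      by auto
    ultimately show ?thesis
      by simp
  qed
  have "is_tree id V {{1, 2}, {1, 3}}"
    unfolding V_def by (rule star_is_tree) (auto simp: doubleton_eq_iff)
  then have tree: "tree_assignment 3 2 I T"
    by (auto simp: tree_assignment_def hyper T_def)
  have E: "E = {((1, V), {1, 2}), ((1, V), {1, 3}), ((2, V), {1, 2}), ((2, V), {1, 3})}"
    by (auto simp: E_def assignment_edges_def hyper T_def)
  then have card: "card E = 2 * (3 - 1)"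
    by (simp add: doubleton_eq_iff)
  obtain fs where fs: "distinct fs" "set fs = E"
    using finite_distinct_list[of E] E by auto
  define \<alpha> :: "nat \<Rightarrow>\<^sub>0 nat" where "\<alpha> = Poly_Mapping.single 1 1 + Poly_Mapping.single 2 1"
  have \<alpha>: "Poly_Mapping.lookup \<alpha> s = (if s \<in> {1..2} then 1 else 0)" for s
    by (auto simp: \<alpha>_def lookup_add lookup_single when_def)
  have keys: "Poly_Mapping.keys \<alpha> \<subseteq> {1..2}"
    by (auto simp: in_keys_iff \<alpha> split: if_splits)
  define A :: "lab_edge set list" where "A = [{((1, V), {1, 2}), ((2, V), {1, 3})}, {((2, V), {1, 2}), ((1, V), {1, 3})}]"
  define B :: "lab_edge set list" where "B = [{((2, V), {1, 2}), ((1, V), {1, 3})}, {((1, V), {1, 2}), ((2, V), {1, 3})}]"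
  have "A \<noteq> B"
    by (auto simp: A_def B_def doubleton_eq_iff)
  have "{Q \<in> D. \<forall>s\<in>{1..2}. sigma 2 E Q s = Poly_Mapping.lookup \<alpha> s} = {Q \<in> D. \<forall>s\<in>{1..2}. sigma 2 E Q s = 1}"
    by (simp add: \<alpha>)
  also have "\<dots> = {A, B}"
    unfolding D_def A_def B_def by (rule cancelling_decompositions[OF refl refl refl refl E])
  finally have AB: "{Q \<in> D. \<forall>s\<in>{1..2}. sigma 2 E Q s = Poly_Mapping.lookup \<alpha> s} = {A, B}" .
  then have "A \<in> D" "B \<in> D"
    by blast+
  obtain \<epsilon> :: "lab_edge set list \<Rightarrow> int" where \<epsilon>: "\<forall>Q\<in>D. \<epsilon> Q \<in> {1, -1}"
    "\<forall>Q\<in>D. (coeff_scalar 3 2 \<epsilon> Q :: bit) \<noteq> 0"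
    "det (M_mat 3 2 fs (Var :: nat \<Rightarrow> bit mpoly)) =
       (\<Sum>Q\<in>D. Const (coeff_scalar 3 2 \<epsilon> Q) * (\<Prod>s=1..2. Var s ^ sigma 2 E Q s))"
    using det_M_mat_decompositions[of 3 2 I T 2 fs, where 'a = bit] tree card fs
    unfolding E_def D_def by auto
  have one: "(coeff_scalar 3 2 \<epsilon> A :: bit) = 1" "(coeff_scalar 3 2 \<epsilon> B :: bit) = 1"
    using \<epsilon>(2) \<open>A \<in> D\<close> \<open>B \<in> D\<close> by simp_all
  have zero: "(\<Sum>Q \<in> {A, B}. (coeff_scalar 3 2 \<epsilon> Q :: bit)) = 0"
    using \<open>A \<noteq> B\<close> by (simp add: one)
  show ?case
    unfolding Let_def
    by (rule exI[of _ 3], rule exI[of _ 2], rule exI[of _ 2], rule exI[of _ I], rule exI[of _ T], rule exI[of _ fs],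
      intro conjI, simp, simp, simp, simp add: I_def, rule tree, rule card[unfolded E_def], rule fs(1),
      rule fs(2)[unfolded E_def], rule exI[of _ \<epsilon>], rule exI[of _ \<alpha>], unfold E_def[symmetric] D_def[symmetric] AB,
      intro conjI \<epsilon>(1) \<epsilon>(3) keys zero insert_not_empty)
qed

end
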